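(* Let $\mu_0=\mathcal N(0,\mathcal C)$ be a centred Gaussian measure on a Hilbert space $H$ and let $(X,\|\cdot\|_X)$ be a Banach space, $X\subseteq H$, with $\mu_0(X)=1$. Let $y\in\mathbb R^m$, let $\Gamma$ be a symmetric positive definite $m\times m$ matrix, and let $\mathcal G:X\to\mathbb R^m$ and $\mathcal G^N:X\to\mathbb R^m$ ($N\in\mathbb N$) be measurable. Put $\Phi(u)=\frac12|y-\mathcal G(u)|_\Gamma^2$ and $\Phi^N(u)=\frac12|y-\mathcal G^N(u)|_\Gamma^2$. Assume that for any $\epsilon>0$ there is $K'=K'(\epsilon)>0$ such that, for all $u\in X$ and all $N$, $$|\mathcal G(u)-\mathcal G^N(u)|\le K'\exp\bigl(\epsilon\|u\|_X^2\bigr)\psi(N),$$ where $\psi(N)\to0$ as $N\to\infty$. Assume also that for every $\epsilon>0$ there is $M=M(\epsilon)\in\mathbb R$ such that, for all $u\in X$ and all $N$, $$|\mathcal G(u)|_\Gamma\le\exp(\epsilon\|u\|_X^2+M),\qquad |\mathcal G^N(u)|_\Gamma\le\exp(\epsilon\|u\|_X^2+M).$$ Then: (a) for every $\epsilon>0$ there is $M'(\epsilon)\in\mathbb R$ with $\Phi(u)\ge M'(\epsilon)-\epsilon\|u\|_X^2$ and $\Phi^N(u)\ge M'(\epsilon)-\epsilon\|u\|_X^2$ for all $u\in X$ and all $N$; for every $r>0$ there is $L(r)>0$ with $\Phi(u)\le L(r)$ and $\Phi^N(u)\le L(r)$ for all $\|u\|_X<r$ and all $N$; and for every $\epsilon>0$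 there is $K(\epsilon)>0$ with $|\Phi(u)-\Phi^N(u)|\le K(\epsilon)\exp(\epsilon\|u\|_X^2)\psi(N)$ for all $u\in X$ and all $N$. (b) With $\mu,\mu^N$ the probability measures on $X$ given by $\frac{d\mu}{d\mu_0}\propto\exp(-\Phi)$ and $\frac{d\mu^N}{d\mu_0}\propto\exp(-\Phi^N)$, there is a constant $C$ independent of $N$ such that $d_{\rm Hell}(\mu,\mu^N)\le C\psi(N)$. Consequently all moments of $\|u\|_X$ under $\mu$ and $\mu^N$ are $\mathcal O(\psi(N))$ close; in particular the means are $\mathcal O(\psi(N))$ close in $X$ and, in the case where $X$ is a Hilbert space, the covariance operators are $\mathcal O(\psi(N))$ close in operator norm.
   Context: $|\cdot|$ is the Euclidean norm on $\mathbb R^m$ and $|\cdot|_\Gamma=|\Gamma^{-1/2}\cdot|$. The Hellinger distance between probability measures $\mu,\mu'$ both absolutely continuous with respect to $\nu$ is $$d_{\rm Hell}(\mu,\mu')=\Bigl(\tfrac12\int\Bigl(\sqrt{\tfrac{d\mu}{d\nu}}-\sqrt{\tfrac{d\mu'}{d\nu}}\Bigr)^2d\nu\Bigr)^{1/2}.$$ "All moments of $\|u\|_X$ are $\mathcal O(\psi(N))$ close" means: for each $p$ there is $C_p$ independent of $N$ with $|\mathbb E^{\mu}\|u\|_X^p-\mathbb E^{\mu^N}\|u\|_X^p|\le C_p\psi(N)$. Standing conventions: $H$ and $X$ are separable, $X$ is continuously embedded in $H$, so $\mu_0$ is regarded as a Gaussian measure on $X$ and Fernique's theorem applies (there is $a>0$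 with $\int_X\exp(a\|u\|_X^2)\,d\mu_0(u)<\infty$). *)

theory Defs
  imports "HOL-Probability.Probability"
begin

definition sym_pos_def :: "real ^ 'm ^ 'm \<Rightarrow> bool" where
  "sym_pos_def A \<longleftrightarrow> transpose A = A \<and> (\<forall>x. x \<noteq> 0 \<longrightarrow> 0 < x \<bullet> (A *v x))"

(* For symmetric positive definite A, the matrix power A^(-1/2), i.e. the unique symmetric
   positive definite square root of the inverse of A. *)
definition inv_sqrt_matrix :: "real ^ 'm ^ 'm \<Rightarrow> real ^ 'm ^ 'm" where
  "inv_sqrt_matrix A = (THE S. sym_pos_def S \<and> S ** S = matrix_inv A)"

definition weighted_norm :: "real ^ 'm ^ 'm \<Rightarrow> real ^ 'm \<Rightarrow> real" where
  "weighted_norm \<Gamma> x = norm (inv_sqrt_matrix \<Gamma> *v x)"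

(* The law N(0, s^2) on the real line; it is the Dirac mass at 0 in the degenerate case s = 0. *)
definition centered_normal :: "real \<Rightarrow> real measure" where
  "centered_normal s =
     (if s = 0 then return borel 0 else density lborel (\<lambda>x. ennreal (normal_density 0 s x)))"

(* mu = N(0, C): every one-dimensional marginal <h, .> has law N(0, <h, C h>).
   That C is trace class is a consequence, not a further requirement. *)
definition centered_gaussian ::
  "('h :: {real_inner, banach, second_countable_topology} \<Rightarrow> 'h) \<Rightarrow> 'h measure \<Rightarrow> bool" where
  "centered_gaussian C \<mu> \<longleftrightarrow>
     bounded_linear C \<and> (\<forall>h k. C h \<bullet> k = h \<bullet> C k) \<and> (\<forall>h. 0 \<le> h \<bullet> C h) \<and>
     prob_space \<mu> \<and> sets \<mu> = sets borel \<and>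
     (\<forall>h. distr \<mu> borel (\<lambda>u. h \<bullet> u) = centered_normal (sqrt (h \<bullet> C h)))"

(* The inclusion of a subspace X of H is represented by an injection j. A measure mu on H with
   mu(X) = 1, regarded as a measure nu on X, is nu(A) = mu(A) for Borel subsets A of X. For a
   continuous injection of Polish spaces all images j ` A are Borel (Lusin-Souslin), so such a nu
   exists; it is clearly unique. *)
definition regarded_on ::
  "('x :: topological_space \<Rightarrow> 'h :: topological_space) \<Rightarrow> 'h measure \<Rightarrow> 'x measure \<Rightarrow> bool" where
  "regarded_on j \<mu> \<nu> \<longleftrightarrow>
     sets \<nu> = sets borel \<and> (\<forall>A \<in> sets borel. emeasure \<nu> A = emeasure \<mu> (j ` A))"

(* The measure with density proportional to exp(-Phi). *)
definition gibbs :: "'a measure \<Rightarrow> ('a \<Rightarrow> real) \<Rightarrow> 'a measure" where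
  "gibbs \<mu>0 \<Phi> = density \<mu>0 (\<lambda>u. ennreal (exp (- \<Phi> u) / (\<integral>v. exp (- \<Phi> v) \<partial>\<mu>0)))"

(* For probability measures that are absolutely continuous with respect to nu. *)
definition hellinger :: "'a measure \<Rightarrow> 'a measure \<Rightarrow> 'a measure \<Rightarrow> real" where
  "hellinger \<nu> \<mu> \<mu>' =
     sqrt (1 / 2 * (\<integral>u. (sqrt (enn2real (RN_deriv \<nu> \<mu> u))
                          - sqrt (enn2real (RN_deriv \<nu> \<mu>' u)))\<^sup>2 \<partial>\<nu>))"

definition mean :: "'x :: {banach, second_countable_topology} measure \<Rightarrow> 'x" where
  "mean \<mu> = (\<integral>u. u \<partial>\<mu>)"

(* A Banach space is a Hilbert space iff its norm comes from such an ip. *)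
definition inner_product_of_norm :: "('x :: real_normed_vector \<Rightarrow> 'x \<Rightarrow> real) \<Rightarrow> bool" where
  "inner_product_of_norm ip \<longleftrightarrow>
     bilinear ip \<and> (\<forall>x y. ip x y = ip y x) \<and> (\<forall>x. ip x x = (norm x)\<^sup>2)"

(* The operator E[(u - m) \<otimes> (u - m)], where m is the mean and (a \<otimes> b) h = <b, h> a. *)
definition covariance_operator ::
  "('x :: {banach, second_countable_topology} \<Rightarrow> 'x \<Rightarrow> real) \<Rightarrow> 'x measure \<Rightarrow> 'x \<Rightarrow> 'x" where
  "covariance_operator ip \<mu> h = (\<integral>u. ip (u - mean \<mu>) h *\<^sub>R (u - mean \<mu>) \<partial>\<mu>)"

end

theory Submission
  imports Defs
begin

text \<open>
  The potentials are nonnegative, so part (a) only uses that \<open>weighted_norm\<close> is a continuous seminorm.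

  For part (b) one needs Fernique's theorem on \<open>X\<close>, that is, invariance of \<open>\<mu>\<^sub>0 \<otimes> \<mu>\<^sub>0\<close> under the rotation
  \<open>(u, v) \<mapsto> ((u + v) / \<surd>2, (u - v) / \<surd>2)\<close>. The functionals \<open>(u, v) \<mapsto> \<langle>h, j u\<rangle> + \<langle>k, j v\<rangle>\<close> have the same
  characteristic functions under both measures and separate points because \<open>j\<close> is injective. On compact
  sets the trigonometric sums in them are dense by Stone-Weierstrass, and finite Borel measures on Polish
  spaces are determined by compact sets; so the measures agree without identifying the dual of \<open>X\<close>.

  Since the potentials are nonnegative and uniformly bounded on a ball of mass at least 1/2, the
  normalisation constants lie in a fixed compact subset of the positive reals, and all differences of
  densities are at most a multiple of \<open>exp (a / 2 * (norm u)\<^sup>2) * \<psi> N\<close> with \<open>a\<close> the Fernique exponent.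
  Moments, means and covariances are then compared directly under \<open>\<mu>\<^sub>0\<close>.
\<close>

section \<open>Uniqueness of measures from trigonometric sums\<close>

lemma norm_integral_le_integral:
  fixes f :: "'a \<Rightarrow> 'b :: {banach, second_countable_topology}"
  assumes "integrable M g" "\<And>x. norm (f x) \<le> g x"
  shows "norm (\<integral>x. f x \<partial>M) \<le> (\<integral>x. g x \<partial>M)"
  by (rule order.trans[OF integral_norm_bound integral_mono'])
    (use assms order.trans[OF norm_ge_zero assms(2)] in simp_all)

text \<open>Real polynomial functions are generated by constants and linear maps under sums and
  products. A linear map of the line is multiplication by its value at 1, so the closure properties
  of \<open>R\<close> cover every case.\<close>

lemma real_polynomial_function_compose_mem:
  fixes R :: "('a \<Rightarrow> real) set"
  assumes add: "\<And>f g. f \<in> R \<Longrightarrow> g \<in> R \<Longrightarrow> (\<lambda>x. f x + g x) \<in> R"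
    and mult: "\<And>f g. f \<in> R \<Longrightarrow> g \<in> R \<Longrightarrow> (\<lambda>x. f x * g x) \<in> R"
    and const: "\<And>c. (\<lambda>_. c) \<in> R"
    and p: "p \<in> R"
    and q: "real_polynomial_function (q :: real \<Rightarrow> real)"
  shows "(\<lambda>x. q (p x)) \<in> R"
  using q
proof induction
  case (linear f)
  have "f t = f 1 * t" for t
    using linear_scale[OF bounded_linear.linear[OF linear], of t 1] by simp
  then have "(\<lambda>x. f (p x)) = (\<lambda>x. f 1 * p x)" by (rule ext)
  then show ?case using mult[OF const p, of "f 1"] by (simp only:)
qed (simp_all only: const add mult)

text \<open>Boundedness makes the members of \<open>R\<close> integrable and puts the range of each
  of them into a compact interval, where polynomial approximation is uniform. Separation of points
  makes \<open>R\<close> dense in the continuous functions on each compact set.\<close>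

locale determining_algebra =
  fixes M N :: "'a :: {second_countable_topology, complete_space} measure"
    and R :: "('a \<Rightarrow> real) set"
  assumes M: "prob_space M" "sets M = sets borel"
    and N: "prob_space N" "sets N = sets borel"
    and continuous: "f \<in> R \<Longrightarrow> continuous_on UNIV f"
    and bounded: "f \<in> R \<Longrightarrow> bounded (range f)"
    and add: "f \<in> R \<Longrightarrow> g \<in> R \<Longrightarrow> (\<lambda>x. f x + g x) \<in> R"
    and mult: "f \<in> R \<Longrightarrow> g \<in> R \<Longrightarrow> (\<lambda>x. f x * g x) \<in> R"
    and const: "(\<lambda>_. c) \<in> R"
    and separable: "x \<noteq> y \<Longrightarrow> \<exists>f\<in>R. f x \<noteq> f y"
    and integral_eq: "f \<in> R \<Longrightarrow> (\<integral>x. f x \<partial>M) = (\<integral>x. f x \<partial>N)"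
begin

text \<open>The conditions are symmetric in the two measures, so a one-sided inequality between them
  already gives equality.\<close>

lemma swap: "determining_algebra N M R"
  by (rule determining_algebra.intro)
    (fact M N continuous bounded add mult const separable integral_eq[symmetric])+

lemma integrable_bounded_continuous:
  assumes "continuous_on UNIV f" "\<And>x. \<bar>f x\<bar> \<le> B"
  shows "integrable M (f :: 'a \<Rightarrow> real)" "integrable N f"
proof -
  interpret M: prob_space M by (rule M)
  interpret N: prob_space N by (rule N)
  have "f \<in> borel_measurable borel" by (intro borel_measurable_continuous_onI assms)
  then have "f \<in> borel_measurable M" "f \<in> borel_measurable N"
    using M N by (auto cong: measurable_cong_sets)
  then show "integrable M f" "integrable N f"
    using assms(2) by (auto intro!: M.integrable_const_bound[where B=B] N.integrable_const_bound[where B=B])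
qed

text \<open>Uniform approximation on the range of \<open>p\<close> by polynomials in \<open>p\<close>.\<close>

lemma integral_continuous_comp_eq:
  fixes \<phi> :: "real \<Rightarrow> real"
  assumes p: "p \<in> R" and \<phi>: "continuous_on UNIV \<phi>"
  shows "(\<integral>x. \<phi> (p x) \<partial>M) = (\<integral>x. \<phi> (p x) \<partial>N)"
proof -
  interpret M: prob_space M by (rule M)
  interpret N: prob_space N by (rule N)
  obtain B where B: "\<And>x. \<bar>p x\<bar> \<le> B" using bounded[OF p] by (auto simp: bounded_iff)
  have cmp: "continuous_on UNIV (\<lambda>x. \<phi> (p x))"
    by (intro continuous_on_compose2[OF \<phi> continuous[OF p]]) auto
  have "bounded (\<phi> ` {-B..B})"
    by (intro compact_imp_bounded compact_continuous_image continuous_on_subset[OF \<phi>]) auto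
  then obtain B' where "\<forall>t\<in>{-B..B}. \<bar>\<phi> t\<bar> \<le> B'"
    by (auto simp: bounded_iff)
  then have B': "\<bar>\<phi> (p x)\<bar> \<le> B'" for x using B[of x] by (auto simp: abs_le_iff)
  note int1 = integrable_bounded_continuous[OF cmp B']
  have "\<bar>(\<integral>x. \<phi> (p x) \<partial>M) - (\<integral>x. \<phi> (p x) \<partial>N)\<bar> \<le> e" if "0 < e" for e
  proof -
    obtain q where q: "real_polynomial_function q" "\<And>t. t \<in> {-B..B} \<Longrightarrow> \<bar>\<phi> t - q t\<bar> < e / 2"
      using Stone_Weierstrass_real_polynomial_function[OF compact_Icc continuous_on_subset[OF \<phi> subset_UNIV], of "e/2" "-B" B]
        \<open>0 < e\<close> by (auto simp del: less_divide_eq_numeral1)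
    have qR: "(\<lambda>x. q (p x)) \<in> R"
      by (rule real_polynomial_function_compose_mem[OF add mult const p q(1)])
    obtain B2 where B2: "\<And>x. \<bar>q (p x)\<bar> \<le> B2" using bounded[OF qR] by (auto simp: bounded_iff)
    note int2 = integrable_bounded_continuous[OF continuous[OF qR] B2]
    have cl: "\<bar>\<phi> (p x) - q (p x)\<bar> \<le> e / 2" for x
      using q(2)[of "p x"] B[of x] by (auto simp: abs_le_iff less_imp_le)
    have "\<bar>(\<integral>x. \<phi> (p x) - q (p x) \<partial>M)\<bar> \<le> (\<integral>x. e / 2 \<partial>M)"
      using int1 int2 cl by (intro norm_integral_le_integral[where 'b=real, unfolded real_norm_def]) auto
    moreover have "\<bar>(\<integral>x. \<phi> (p x) - q (p x) \<partial>N)\<bar> \<le> (\<integral>x. e / 2 \<partial>N)"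
      using int1 int2 cl by (intro norm_integral_le_integral[where 'b=real, unfolded real_norm_def]) auto
    ultimately have "\<bar>(\<integral>x. \<phi> (p x) \<partial>M) - (\<integral>x. q (p x) \<partial>N)\<bar> \<le> e / 2"
      "\<bar>(\<integral>x. \<phi> (p x) \<partial>N) - (\<integral>x. q (p x) \<partial>N)\<bar> \<le> e / 2"
      using int1 int2 integral_eq[OF qR] M.prob_space N.prob_space by simp_all
    then show ?thesis by linarith
  qed
  then have "\<bar>(\<integral>x. \<phi> (p x) \<partial>M) - (\<integral>x. \<phi> (p x) \<partial>N)\<bar> \<le> 0"
    by (rule dense_ge)
  then show ?thesis by simp
qed

text \<open>A bump function that is 1 on \<open>K\<close> and 0 off a slightly larger open set
  \<open>U\<close> is approximated by some \<open>p\<close> in \<open>R\<close>, but only on compact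
  sets. Clipping \<open>p\<close> to the unit interval keeps it harmless elsewhere and leaves a
  continuous function of \<open>p\<close>, whose integrals under both measures agree.\<close>

lemma measure_compact_le:
  assumes K: "compact K"
  shows "measure M K \<le> measure N K"
proof (rule field_le_epsilon)
  fix e :: real assume "0 < e"
  \<comment> \<open>Four errors of size \<open>\<delta>\<close> occur: the approximation on
    \<open>K\<close>, the approximation on \<open>K'\<close>, the excess of \<open>U\<close> over
    \<open>K\<close>, and the mass outside \<open>K'\<close>.\<close>
  define \<delta> where "\<delta> = e / 4"
  have \<delta>: "0 < \<delta>" using \<open>0 < e\<close> by (simp add: \<delta>_def)
  interpret M: prob_space M by (rule M)
  interpret N: prob_space N by (rule N)
  have space[simp]: "space M = UNIV" "space N = UNIV"
    using M(2) N(2) by (auto dest: sets_eq_imp_space_eq)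
  note [simp] = M(2) N(2)
  have [simp]: "K \<in> sets borel" using K by (simp add: compact_imp_closed borel_closed)
  show "measure M K \<le> measure N K + e"
  \<comment> \<open>\<open>infdist\<close> to the empty set is 0 by convention, so the bump function
    below makes sense only for nonempty \<open>K\<close>.\<close>
  proof (cases "K = {}")
    case False
    have "emeasure N K < emeasure N K + ennreal \<delta>"
      using \<delta> by (simp add: N.emeasure_eq_measure ennreal_less_iff flip: ennreal_plus)
    then have "(INF U \<in> {U. K \<subseteq> U \<and> open U}. emeasure N U) < emeasure N K + ennreal \<delta>"
      by (rule order.strict_trans1[OF eq_refl[OF outer_regular[symmetric]], rotated -1])
        (use N in auto)
    then obtain U where U: "K \<subseteq> U" "open U" "emeasure N U < emeasure N K + ennreal \<delta>"
      by (auto simp: INF_less_iff)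
    then have NU: "measure N U \<le> measure N K + \<delta>"
      using \<delta> by (simp add: N.emeasure_eq_measure ennreal_less_iff flip: ennreal_plus)
    \<comment> \<open>Inner regularity of the whole space is tightness: a compact \<open>K'\<close>
      carries all but \<open>\<delta>\<close> of the mass of \<open>N\<close>.\<close>
    have "emeasure N UNIV - ennreal \<delta> < emeasure N UNIV"
      using \<delta> N.emeasure_space_1 by (simp add: ennreal_minus ennreal_lessI flip: ennreal_1)
    then have "emeasure N UNIV - ennreal \<delta> < (SUP K \<in> {K. K \<subseteq> UNIV \<and> compact K}. emeasure N K)"
      by (rule order.strict_trans2[OF _ eq_refl[OF inner_regular]]) (use N in auto)
    then obtain K' where K': "compact K'" "emeasure N UNIV - ennreal \<delta> < emeasure N K'"
      by (auto simp: less_SUP_iff)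
    have [simp]: "K' \<in> sets borel" "U \<in> sets borel"
      using K' U by (simp_all add: compact_imp_closed borel_closed)
    have [simp]: "- K' \<in> sets borel"
      using K' by (intro borel_open) (simp add: compact_imp_closed open_Compl)
    have "ennreal (1 - \<delta>) < ennreal (measure N K')"
      using K'(2) N.emeasure_space_1 \<delta> by (simp add: N.emeasure_eq_measure ennreal_minus flip: ennreal_1)
    then have "1 - \<delta> \<le> measure N K'"
      using ennreal_leI[of "measure N K'" "1 - \<delta>"] by (meson leD linear)
    then have NK': "measure N (- K') \<le> \<delta>"
      using N.prob_compl[of K'] \<open>K' \<in> sets borel\<close> N(2) by (simp add: Compl_eq_Diff_UNIV)
    obtain d where d: "0 < d" "\<And>x y. x \<in> K \<Longrightarrow> y \<in> - U \<Longrightarrow> d \<le> dist x y"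
    proof -
      \<comment> \<open>\<open>d\<close> is a Lebesgue number of the one-element cover
        \<open>{U}\<close> of \<open>K\<close>.\<close>
      obtain d where d: "0 < d" "\<And>x. x \<in> K \<Longrightarrow> ball x d \<subseteq> U"
        using Heine_Borel_lemma[OF K, of "{U}"] U by auto
      have "d \<le> dist x y" if "x \<in> K" "y \<in> - U" for x y
        using d(2)[OF that(1)] that(2) by (auto simp: subset_iff not_less[symmetric])
      with d(1) show ?thesis by (rule that)
    qed
    define f where "f x = max 0 (1 - infdist x K / d)" for x
    have f_cont: "continuous_on UNIV f" unfolding f_def
      by (intro continuous_intros) (use d in auto)
    have fK: "f x = 1" if "x \<in> K" for x using that by (simp add: f_def)
    have fU: "f x = 0" if "x \<notin> U" for x
    proof -
      have "d \<le> infdist x K"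
        using d(2) that False by (auto simp: infdist_def dist_commute intro!: cINF_greatest)
      then show ?thesis using d by (simp add: f_def)
    qed
    have f01: "0 \<le> f x" "f x \<le> 1" for x
      using d by (auto simp: f_def infdist_nonneg)
    note R_continuous = continuous
    interpret function_ring_on R "K \<union> K'"
      using K K' continuous add mult const separable
      by unfold_locales (auto intro: continuous_on_subset)
    obtain p where p: "p \<in> R" "\<And>x. x \<in> K \<union> K' \<Longrightarrow> \<bar>f x - p x\<bar> < \<delta>"
      using Stone_Weierstrass_basic[OF continuous_on_subset[OF f_cont] \<delta>] by auto
    \<comment> \<open>Off \<open>K \<union> K'\<close> nothing is known about \<open>p\<close>. The
      clipped function is still at most 1 there, which costs no more than the mass of the complement
      of \<open>K'\<close>.\<close>
    define q where "q x = max 0 (min 1 (p x))" for x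
    have q01: "0 \<le> q x" "q x \<le> 1" for x by (auto simp: q_def)
    have qf: "\<bar>f x - q x\<bar> \<le> \<delta>" if "x \<in> K \<union> K'" for x
      using p(2)[OF that] f01[of x] by (auto simp: q_def)
    have "continuous_on UNIV q" unfolding q_def
      by (intro continuous_intros R_continuous p)
    note int = integrable_bounded_continuous[OF this, of 1]
    have [simp]: "integrable M q" "integrable N q" using int q01 by auto
    have "(\<integral>x. indicator K x \<partial>M) \<le> (\<integral>x. q x + \<delta> \<partial>M)"
    proof (intro integral_mono)
      show "indicator K x \<le> q x + \<delta>" for x
        using qf[of x] fK[of x] q01[of x] \<delta> by (cases "x \<in> K") auto
    qed (auto simp: M.emeasure_eq_measure)
    also have "\<dots> = (\<integral>x. q x \<partial>M) + \<delta>" using M.prob_space by simp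
    also have "(\<integral>x. q x \<partial>M) = (\<integral>x. q x \<partial>N)"
      unfolding q_def by (intro integral_continuous_comp_eq[OF p(1), of "\<lambda>t. max 0 (min 1 t)"] continuous_intros)
    also have "(\<integral>x. q x \<partial>N) \<le> (\<integral>x. indicator U x + \<delta> + indicator (- K') x \<partial>N)"
    proof (intro integral_mono)
      show "q x \<le> indicator U x + \<delta> + indicator (- K') x" for x
        using qf[of x] fU[of x] f01[of x] q01[of x] \<delta>
        by (cases "x \<in> K'"; cases "x \<in> U") (auto simp: indicator_def)
    qed (auto simp: N.emeasure_eq_measure)
    also have "\<dots> = measure N U + \<delta> + measure N (- K')"
      using N.prob_space by (simp add: N.emeasure_eq_measure)
    also have "\<dots> \<le> measure N K + \<delta> + \<delta> + \<delta>" using NU NK' by simp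
    finally show ?thesis by (simp add: \<delta>_def)
  qed (use \<open>0 < e\<close> in auto)
qed

text \<open>Compact sets have equal mass by \<open>measure_compact_le\<close> in both directions,
  and inner regularity passes this on to all Borel sets.\<close>

theorem measures_eq: "M = N"
proof (rule measure_eqI)
  interpret M: prob_space M by (rule M)
  interpret N: prob_space N by (rule N)
  interpret NM: determining_algebra N M R by (rule swap)
  fix A assume "A \<in> sets M"
  then have "A \<in> sets borel" using M by simp
  have "emeasure M K = emeasure N K" if "compact K" for K
    using measure_compact_le[OF that] NM.measure_compact_le[OF that]
    by (simp add: M.emeasure_eq_measure N.emeasure_eq_measure)
  then have sup: "(SUP K \<in> {K. K \<subseteq> A \<and> compact K}. emeasure M K) = (SUP K \<in> {K. K \<subseteq> A \<and> compact K}. emeasure N K)"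
    by (intro SUP_cong) auto
  show "emeasure M A = emeasure N A"
    by (rule trans[OF inner_regular[OF M(2) _ \<open>A \<in> sets borel\<close>]
      trans[OF sup inner_regular[OF N(2) _ \<open>A \<in> sets borel\<close>, symmetric]]]) simp_all
qed (use M N in simp)

end

section \<open>Trigonometric sums and uniqueness from characteristic functions\<close>

inductive_set trigonometric_sums :: "('a \<Rightarrow> real) set \<Rightarrow> ('a \<Rightarrow> real) set" for L where
  cos: "l \<in> L \<Longrightarrow> (\<lambda>x. a * cos (l x + c)) \<in> trigonometric_sums L"
| add: "f \<in> trigonometric_sums L \<Longrightarrow> g \<in> trigonometric_sums L \<Longrightarrow>
        (\<lambda>x. f x + g x) \<in> trigonometric_sums L"

lemma trigonometric_sums_mult:
  assumes L: "\<And>l l'. l \<in> L \<Longrightarrow> l' \<in> L \<Longrightarrow> (\<lambda>x. l x + l' x) \<in> L"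
    "\<And>l r. l \<in> L \<Longrightarrow> (\<lambda>x. r * l x) \<in> L"
  assumes "f \<in> trigonometric_sums L" "g \<in> trigonometric_sums L"
  shows "(\<lambda>x. f x * g x) \<in> trigonometric_sums L"
  using assms(3)
proof induction
  case f: (cos l a c)
  show ?case using assms(4)
  proof induction
    case (cos l' a' c')
    have "(\<lambda>x. l x + - 1 * l' x) \<in> L" by (intro L f cos)
    then have "(\<lambda>x. a * a' / 2 * cos ((l x + - 1 * l' x) + (c - c')) + a * a' / 2 * cos ((l x + l' x) + (c + c')))
       \<in> trigonometric_sums L"
      by (intro trigonometric_sums.add trigonometric_sums.cos L f cos)
    also have "(\<lambda>x. a * a' / 2 * cos ((l x + - 1 * l' x) + (c - c')) + a * a' / 2 * cos ((l x + l' x) + (c + c'))) =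
      (\<lambda>x. a * cos (l x + c) * (a' * cos (l' x + c')))" (is "?f = ?g")
    proof
      fix x
      have "(l x + - 1 * l' x) + (c - c') = (l x + c) - (l' x + c')"
        "(l x + l' x) + (c + c') = (l x + c) + (l' x + c')" by simp_all
      then have "cos (l x + c) * cos (l' x + c') =
        (cos ((l x + - 1 * l' x) + (c - c')) + cos ((l x + l' x) + (c + c'))) / 2"
        by (simp only: cos_times_cos)
      then show "?f x = ?g x" by (simp add: field_simps)
    qed
    finally show ?case .
  next
    case (add g g')
    then show ?case by (simp add: distrib_left trigonometric_sums.add)
  qed
next
  case (add f f')
  then show ?case by (simp add: distrib_right trigonometric_sums.add)
qed

text \<open>The characteristic functions along \<open>L\<close> fix the integrals of all cosines
  with arbitrary phase, hence of all trigonometric sums, and these form a determining algebra. Any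
  linear space \<open>L\<close> of continuous functions that separates points will do; below it
  consists of functionals pulled back from a Hilbert space.\<close>

theorem prob_measure_eqI_iexp:
  fixes M N :: "'a :: {second_countable_topology, complete_space} measure"
    and L :: "('a \<Rightarrow> real) set"
  assumes M: "prob_space M" "sets M = sets borel"
    and N: "prob_space N" "sets N = sets borel"
    and continuous: "\<And>l. l \<in> L \<Longrightarrow> continuous_on UNIV l"
    and zero: "(\<lambda>_. 0) \<in> L"
    and plus: "\<And>l l'. l \<in> L \<Longrightarrow> l' \<in> L \<Longrightarrow> (\<lambda>x. l x + l' x) \<in> L"
    and scale: "\<And>l r. l \<in> L \<Longrightarrow> (\<lambda>x. r * l x) \<in> L"
    and separable: "\<And>x y. x \<noteq> y \<Longrightarrow> \<exists>l\<in>L. l x \<noteq> l y"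
    and iexp_eq: "\<And>l. l \<in> L \<Longrightarrow> (\<integral>x. iexp (l x) \<partial>M) = (\<integral>x. iexp (l x) \<partial>N)"
  shows "M = N"
proof -
  interpret M: prob_space M by (rule M)
  interpret N: prob_space N by (rule N)
  have cont: "continuous_on UNIV f" and bdd: "\<exists>B. \<forall>x. \<bar>f x\<bar> \<le> B"
    if "f \<in> trigonometric_sums L" for f
    using that
  proof induction
    case (cos l a c)
    { case 1 show ?case by (intro continuous_intros continuous cos) }
    { case 2 show ?case
      by (intro exI[of _ "\<bar>a\<bar>"]) (auto simp: abs_mult intro: mult_left_le) }
  next
    case (add f g)
    { case 1 show ?case by (intro continuous_intros add) }
    { case 2
      obtain B B' where "\<And>x. \<bar>f x\<bar> \<le> B" "\<And>x. \<bar>g x\<bar> \<le> B'" using add by blast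
      then have "\<bar>f x + g x\<bar> \<le> B + B'" for x
        by (meson abs_triangle_ineq add_mono order_trans)
      then show ?case by blast }
  qed
  have meas: "f \<in> borel_measurable M" "f \<in> borel_measurable N"
    if "continuous_on UNIV f" for f :: "'a \<Rightarrow> real"
    using borel_measurable_continuous_onI[OF that] M N by (auto cong: measurable_cong_sets)
  have int: "integrable M f" "integrable N f" if "f \<in> trigonometric_sums L" for f
  proof -
    from bdd[OF that] obtain B where "\<And>x. \<bar>f x\<bar> \<le> B" by blast
    then show "integrable M f" "integrable N f"
      using meas[OF cont[OF that]]
      by (auto intro!: M.integrable_const_bound[where B=B] N.integrable_const_bound[where B=B])
  qed
  \<comment> \<open>The phase becomes the constant factor \<open>iexp c\<close>, so that only the
    integral of \<open>iexp (l x)\<close> depends on the measure.\<close>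
  have cos_Re: "cos (t + c) = Re (iexp t * iexp c)" for t c :: real
    by (simp add: cos_add flip: cis_conv_exp)
  have eq: "(\<integral>x. f x \<partial>M) = (\<integral>x. f x \<partial>N)" if "f \<in> trigonometric_sums L" for f
    using that
  proof induction
    case (cos l a c)
    note l = meas[OF continuous[OF cos]]
    have [simp]: "complex_integrable M (\<lambda>x. iexp (l x))" "complex_integrable N (\<lambda>x. iexp (l x))"
      using l by (auto intro!: M.integrable_iexp N.integrable_iexp)
    have "(\<integral>x. cos (l x + c) \<partial>P) = Re ((\<integral>x. iexp (l x) \<partial>P) * iexp c)"
      if "complex_integrable P (\<lambda>x. iexp (l x))" for P :: "'a measure"
    proof -
      have "Re ((\<integral>x. iexp (l x) \<partial>P) * iexp c) = Re (\<integral>x. iexp (l x) * iexp c \<partial>P)"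
        by (simp only: integral_mult_left_zero)
      also have "\<dots> = (\<integral>x. Re (iexp (l x) * iexp c) \<partial>P)"
        using that by (intro integral_Re[symmetric] integrable_mult_left)
      finally show ?thesis by (simp only: cos_Re)
    qed
    then show ?case using iexp_eq[OF cos] by simp
  next
    case (add f g)
    then show ?case using int by simp
  qed
  interpret determining_algebra M N "trigonometric_sums L"
  proof (rule determining_algebra.intro)
    show "bounded (range f)" if "f \<in> trigonometric_sums L" for f
      using bdd[OF that] by (auto simp: bounded_iff)
    show "(\<lambda>_. c) \<in> trigonometric_sums L" for c
      using trigonometric_sums.cos[OF zero, of c 0] by simp
    show "\<exists>f\<in>trigonometric_sums L. f x \<noteq> f y" if "x \<noteq> y" for x y
    proof -
      from separable[OF that] obtain l where l: "l \<in> L" "l x \<noteq> l y" by auto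
      \<comment> \<open>With this scaling and the phase \<open>- r * l x\<close> the cosine is 1 at
        \<open>x\<close> and \<open>cos pi = - 1\<close> at \<open>y\<close>.\<close>
      define r where "r = pi / (l y - l x)"
      have r: "r * l y - r * l x = pi"
        unfolding right_diff_distrib[symmetric] using l by (simp add: r_def)
      have "(\<lambda>z. 1 * cos (r * l z + - r * l x)) \<in> trigonometric_sums L"
        by (intro trigonometric_sums.cos scale l)
      moreover have "cos (r * l x + - r * l x) \<noteq> cos (r * l y + - r * l x)"
        using r by simp
      ultimately show ?thesis
        by (intro bexI[of _ "\<lambda>z. 1 * cos (r * l z + - r * l x)"]) simp_all
    qed
    show "(\<lambda>x. f x * g x) \<in> trigonometric_sums L"
      if "f \<in> trigonometric_sums L" "g \<in> trigonometric_sums L" for f g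
      by (rule trigonometric_sums_mult[OF plus scale that])
    show "(\<lambda>x. f x + g x) \<in> trigonometric_sums L"
      if "f \<in> trigonometric_sums L" "g \<in> trigonometric_sums L" for f g
      using that by (rule trigonometric_sums.add)
  qed (fact M N cont eq)+
  show ?thesis by (rule measures_eq)
qed

section \<open>Rotation invariance and the Fernique theorem\<close>

text \<open>The substitution \<open>x = s * t\<close> turns this into the characteristic function of
  the standard normal law at \<open>s\<close>. Frequency 1 suffices because the direction
  \<open>h\<close> of a marginal, and with it \<open>s\<close>, can be varied instead.\<close>

lemma CLINT_iexp_centered_normal:
  assumes "0 \<le> s"
  shows "(\<integral>x. iexp x \<partial>centered_normal s) = of_real (exp (- s\<^sup>2 / 2))"
proof (cases "s = 0")
  case True
  then show ?thesis by (simp add: centered_normal_def integral_return)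
next
  case False
  then have s: "0 < s" using assms by simp
  have "(\<integral>x. iexp x \<partial>centered_normal s) = (\<integral>x. normal_density 0 s x *\<^sub>R iexp x \<partial>lborel)"
    using False by (simp add: centered_normal_def integral_density)
  also have "\<dots> = \<bar>s\<bar> *\<^sub>R (\<integral>x. normal_density 0 s (0 + s * x) *\<^sub>R iexp (0 + s * x) \<partial>lborel)"
    using False by (rule lborel_integral_real_affine)
  also have "\<dots> = (\<integral>x. std_normal_density x *\<^sub>R iexp (s * x) \<partial>lborel)"
  proof -
    have "std_normal_density x = s * normal_density 0 s (s * x)" for x
      using s by (simp add: normal_density_def real_sqrt_mult power_mult_distrib field_simps)
    then have "s *\<^sub>R normal_density 0 s (0 + s * x) *\<^sub>R iexp (0 + s * x) = std_normal_density x *\<^sub>R iexp (s * x)" for x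
      by simp
    then show ?thesis using s by (simp flip: integral_scaleR_right)
  qed
  also have "\<dots> = char std_normal_distribution s"
    by (simp add: char_def integral_density)
  also have "\<dots> = of_real (exp (- s\<^sup>2 / 2))"
    by (simp add: char_std_normal_distribution)
  finally show ?thesis .
qed

definition rotate_pair :: "'a :: real_normed_vector \<times> 'a \<Rightarrow> 'a \<times> 'a" where
  "rotate_pair = (\<lambda>(u, v). ((1 / sqrt 2) *\<^sub>R (u + v), (1 / sqrt 2) *\<^sub>R (u - v)))"

lemma continuous_on_rotate_pair: "continuous_on S rotate_pair"
  unfolding rotate_pair_def case_prod_beta by (intro continuous_intros)

lemma (in pair_prob_space) CLINT_iexp_plus:
  assumes [measurable]: "f \<in> borel_measurable M1" "g \<in> borel_measurable M2"
  shows "(\<integral>z. iexp (f (fst z) + g (snd z)) \<partial>(M1 \<Otimes>\<^sub>M M2)) = (\<integral>x. iexp (f x) \<partial>M1) * (\<integral>y. iexp (g y) \<partial>M2)"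
proof -
  have "integrable (M1 \<Otimes>\<^sub>M M2) (\<lambda>z. iexp (f (fst z) + g (snd z)))"
    by (intro integrable_iexp) simp_all
  then have "(\<integral>z. iexp (f (fst z) + g (snd z)) \<partial>(M1 \<Otimes>\<^sub>M M2)) = (\<integral>x. \<integral>y. iexp (f x) * iexp (g y) \<partial>M2 \<partial>M1)"
    by (subst integral_fst'[symmetric]) (simp_all add: distrib_left exp_add)
  then show ?thesis by (simp only: integral_mult_right_zero integral_mult_left_zero)
qed

text \<open>The characteristic function of the product measure depends on \<open>(h, k)\<close> only
  through \<open>h \<bullet> C h + k \<bullet> C k\<close>, and the parallelogram identity makes
  this sum invariant under rotation of \<open>(h, k)\<close>.\<close>

theorem rotation_invariant_if_gaussian_functionals:
  fixes j :: "'x :: {banach, second_countable_topology} \<Rightarrow> 'h :: {real_inner, second_countable_topology}"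
  assumes j: "bounded_linear j" "inj j"
    and \<nu>: "prob_space \<nu>" "sets \<nu> = sets borel"
    and C: "bounded_linear C" "\<And>h. 0 \<le> h \<bullet> C h"
    and gauss: "\<And>h. distr \<nu> borel (\<lambda>u. h \<bullet> j u) = centered_normal (sqrt (h \<bullet> C h))"
  shows "distr (\<nu> \<Otimes>\<^sub>M \<nu>) borel rotate_pair = \<nu> \<Otimes>\<^sub>M \<nu>"
proof -
  interpret \<nu>: prob_space \<nu> by (rule \<nu>)
  interpret P: pair_prob_space \<nu> \<nu> ..
  interpret j: bounded_linear j by (rule j)
  interpret C: bounded_linear C by (rule C)
  have sets_P: "sets (\<nu> \<Otimes>\<^sub>M \<nu>) = sets borel"
    using \<nu> by (simp add: borel_prod[symmetric] cong: sets_pair_measure_cong)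
  have rot[measurable]: "rotate_pair \<in> \<nu> \<Otimes>\<^sub>M \<nu> \<rightarrow>\<^sub>M borel"
    using borel_measurable_continuous_onI[OF continuous_on_rotate_pair] sets_P
    by (simp cong: measurable_cong_sets)
  have j_cont: "continuous_on S (\<lambda>u. h \<bullet> j u)" for h and S :: "'x set"
    by (intro continuous_intros j.continuous_on)
  have j_meas[measurable]: "(\<lambda>u. h \<bullet> j u) \<in> borel_measurable \<nu>" for h
    using borel_measurable_continuous_onI[OF j_cont] \<nu>(2) by (simp cong: measurable_cong_sets)
  have char: "(\<integral>u. iexp (h \<bullet> j u) \<partial>\<nu>) = of_real (exp (- (h \<bullet> C h) / 2))" for h
  proof -
    have "(\<integral>u. iexp (h \<bullet> j u) \<partial>\<nu>) = (\<integral>x. iexp x \<partial>distr \<nu> borel (\<lambda>u. h \<bullet> j u))"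
      by (subst integral_distr) simp_all
    then show ?thesis using C(2)[of h] by (simp add: gauss CLINT_iexp_centered_normal)
  qed
  have char_P: "(\<integral>z. iexp (h \<bullet> j (fst z) + k \<bullet> j (snd z)) \<partial>(\<nu> \<Otimes>\<^sub>M \<nu>)) =
      of_real (exp (- (h \<bullet> C h + k \<bullet> C k) / 2))" for h k
    unfolding P.CLINT_iexp_plus[OF j_meas j_meas] char
    by (simp flip: exp_add of_real_mult add: field_simps)
  define L where "L = {l. \<exists>h k. l = (\<lambda>z::'x \<times> 'x. h \<bullet> j (fst z) + k \<bullet> j (snd z))}"
  show ?thesis
  proof (rule prob_measure_eqI_iexp[where L = L])
    show "prob_space (distr (\<nu> \<Otimes>\<^sub>M \<nu>) borel rotate_pair)" by (rule P.prob_space_distr[OF rot])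
    show "prob_space (\<nu> \<Otimes>\<^sub>M \<nu>)" by (rule P.prob_space_axioms)
    show "sets (distr (\<nu> \<Otimes>\<^sub>M \<nu>) borel rotate_pair) = sets borel" by simp
    show "sets (\<nu> \<Otimes>\<^sub>M \<nu>) = sets borel" by (rule sets_P)
    show l_cont: "continuous_on UNIV l" if "l \<in> L" for l
      using that by (auto simp: L_def intro!: continuous_intros j.continuous_on)
    show "(\<lambda>_. 0) \<in> L" by (auto simp: L_def intro!: exI[of _ 0])
    show "(\<lambda>x. l x + l' x) \<in> L" if ll: "l \<in> L" "l' \<in> L" for l l'
    proof -
      obtain h k h' k' where "l = (\<lambda>z. h \<bullet> j (fst z) + k \<bullet> j (snd z))"
        "l' = (\<lambda>z. h' \<bullet> j (fst z) + k' \<bullet> j (snd z))" using ll[unfolded L_def] by auto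
      then have "(\<lambda>x. l x + l' x) = (\<lambda>z. (h + h') \<bullet> j (fst z) + (k + k') \<bullet> j (snd z))"
        by (simp add: inner_add_left algebra_simps)
      then show ?thesis unfolding L_def by blast
    qed
    show "(\<lambda>x. r * l x) \<in> L" if l: "l \<in> L" for l r
    proof -
      obtain h k where "l = (\<lambda>z. h \<bullet> j (fst z) + k \<bullet> j (snd z))"
        using l[unfolded L_def] by auto
      then have "(\<lambda>x. r * l x) = (\<lambda>z. (r *\<^sub>R h) \<bullet> j (fst z) + (r *\<^sub>R k) \<bullet> j (snd z))"
        by (simp add: algebra_simps)
      then show ?thesis unfolding L_def by blast
    qed
    show "\<exists>l\<in>L. l x \<noteq> l y" if "x \<noteq> y" for x y
    proof -
      \<comment> \<open>Testing with the difference itself: the two values differ by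
        \<open>h \<bullet> h + k \<bullet> k\<close>, which is positive because \<open>j\<close> is
        injective.\<close>
      define h k where "h = j (fst x) - j (fst y)" and "k = j (snd x) - j (snd y)"
      have "h \<noteq> 0 \<or> k \<noteq> 0"
        using that j(2) by (auto simp: h_def k_def prod_eq_iff dest: injD)
      then have "0 < h \<bullet> h + k \<bullet> k"
        by (metis add_nonneg_pos add_pos_nonneg inner_ge_zero inner_gt_zero_iff)
      then have "h \<bullet> j (fst x) + k \<bullet> j (snd x) \<noteq> h \<bullet> j (fst y) + k \<bullet> j (snd y)"
        by (subst (asm) (2) h_def, subst (asm) (2) k_def) (simp add: inner_diff_right)
      then show ?thesis
        by (intro bexI[of _ "\<lambda>z. h \<bullet> j (fst z) + k \<bullet> j (snd z)"]) (auto simp: L_def)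
    qed
    show "(\<integral>z. iexp (l z) \<partial>distr (\<nu> \<Otimes>\<^sub>M \<nu>) borel rotate_pair) = (\<integral>z. iexp (l z) \<partial>(\<nu> \<Otimes>\<^sub>M \<nu>))"
      if l: "l \<in> L" for l
    proof -
      obtain h k where hk: "l = (\<lambda>z. h \<bullet> j (fst z) + k \<bullet> j (snd z))"
        using l[unfolded L_def] by auto
      have [measurable]: "l \<in> borel_measurable borel"
        by (rule borel_measurable_continuous_onI[OF l_cont[OF l]])
      \<comment> \<open>The matrix of the rotation is symmetric, so moving it from the pair of
        points to the pair of coefficients keeps the same formula.\<close>
      define h' k' where "h' = (1 / sqrt 2) *\<^sub>R (h + k)" and "k' = (1 / sqrt 2) *\<^sub>R (h - k)"
      have "l (rotate_pair z) = h' \<bullet> j (fst z) + k' \<bullet> j (snd z)" for z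
        by (simp add: hk h'_def k'_def rotate_pair_def case_prod_beta j.scaleR j.add j.diff
            inner_add_left inner_add_right inner_diff_left inner_diff_right algebra_simps)
      then have "(\<integral>z. iexp (l z) \<partial>distr (\<nu> \<Otimes>\<^sub>M \<nu>) borel rotate_pair) =
          (\<integral>z. iexp (h' \<bullet> j (fst z) + k' \<bullet> j (snd z)) \<partial>(\<nu> \<Otimes>\<^sub>M \<nu>))"
        by (subst integral_distr) simp_all
      also have "\<dots> = of_real (exp (- (h' \<bullet> C h' + k' \<bullet> C k') / 2))" by (rule char_P)
      \<comment> \<open>Parallelogram identity: the mixed terms in \<open>h\<close> and
        \<open>k\<close> cancel.\<close>
      also have "h' \<bullet> C h' + k' \<bullet> C k' = h \<bullet> C h + k \<bullet> C k"
        by (simp add: h'_def k'_def C.scaleR C.add C.diff inner_add_left inner_add_right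
            inner_diff_left inner_diff_right field_simps)
      finally show ?thesis by (simp only: hk char_P)
    qed
  qed
qed

text \<open>The left side is the mass of a product set. By invariance it is also the mass of the
  pairs with \<open>norm (u - v) / sqrt 2 \<le> s\<close> and
  \<open>norm (u + v) / sqrt 2 > s + sqrt 2 * t\<close>. For these the triangle inequality forces
  both norms above \<open>t\<close>, and independence gives the square.\<close>

lemma fernique_tail_step:
  fixes \<nu> :: "'x :: {real_normed_vector, second_countable_topology} measure"
  assumes \<nu>: "prob_space \<nu>" "sets \<nu> = sets borel"
    and rot: "distr (\<nu> \<Otimes>\<^sub>M \<nu>) borel rotate_pair = \<nu> \<Otimes>\<^sub>M \<nu>"
  shows "measure \<nu> {u. norm u \<le> s} * measure \<nu> {u. s + sqrt 2 * t < norm u} \<le> (measure \<nu> {u. t < norm u})\<^sup>2"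
proof -
  interpret \<nu>: prob_space \<nu> by (rule \<nu>)
  interpret P: pair_prob_space \<nu> \<nu> ..
  have sets_P: "sets (\<nu> \<Otimes>\<^sub>M \<nu>) = sets borel"
    using \<nu> by (simp add: borel_prod[symmetric] cong: sets_pair_measure_cong)
  have rot_meas: "rotate_pair \<in> \<nu> \<Otimes>\<^sub>M \<nu> \<rightarrow>\<^sub>M borel"
    using borel_measurable_continuous_onI[OF continuous_on_rotate_pair] sets_P
    by (simp cong: measurable_cong_sets)
  have le[simp]: "{u. norm u \<le> r} \<in> sets \<nu>" and gt[simp]: "{u. r < norm u} \<in> sets \<nu>" for r
    unfolding \<nu>(2) by measurable
  let ?A = "{u. s + sqrt 2 * t < norm u} \<times> {u. norm u \<le> s}"
  let ?B = "{u. t < norm u} \<times> {u. t < norm u}"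
  have Times: "measure (\<nu> \<Otimes>\<^sub>M \<nu>) (A \<times> B) = measure \<nu> A * measure \<nu> B"
    if "A \<in> sets \<nu>" "B \<in> sets \<nu>" for A B
    using that by (simp add: measure_def \<nu>.emeasure_pair_measure_Times enn2real_mult)
  have "measure (\<nu> \<Otimes>\<^sub>M \<nu>) ?A = measure (distr (\<nu> \<Otimes>\<^sub>M \<nu>) borel rotate_pair) ?A"
    by (simp only: rot)
  also have "\<dots> = measure (\<nu> \<Otimes>\<^sub>M \<nu>) (rotate_pair -` ?A \<inter> space (\<nu> \<Otimes>\<^sub>M \<nu>))"
    by (rule measure_distr[OF rot_meas]) (use sets_P in \<open>auto simp flip: sets_P\<close>)
  also have "\<dots> \<le> measure (\<nu> \<Otimes>\<^sub>M \<nu>) ?B"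
  proof (rule P.finite_measure_mono)
    show "rotate_pair -` ?A \<inter> space (\<nu> \<Otimes>\<^sub>M \<nu>) \<subseteq> ?B"
    proof
      fix z assume z: "z \<in> rotate_pair -` ?A \<inter> space (\<nu> \<Otimes>\<^sub>M \<nu>)"
      obtain u v where uv: "z = (u, v)" by fastforce
      then have *: "s + sqrt 2 * t < norm (u + v) / sqrt 2" "norm (u - v) / sqrt 2 \<le> s"
        using z by (auto simp: uv rotate_pair_def)
      have "sqrt 2 * (sqrt 2 * t) = 2 * t" by simp
      with * have "2 * t < norm (u + v) - norm (u - v)"
        by (simp add: field_simps)
      moreover have "norm (u + v) - norm (u - v) \<le> 2 * norm u"
        using norm_triangle_ineq2[of "u + v" "v - u"]
        by (simp add: norm_minus_commute flip: scaleR_2)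
      moreover have "norm (u + v) - norm (u - v) \<le> 2 * norm v"
        using norm_triangle_ineq2[of "u + v" "u - v"] by (simp flip: scaleR_2)
      ultimately show "z \<in> ?B" by (simp add: uv)
    qed
  qed simp
  finally show ?thesis by (simp add: Times power2_eq_square mult.commute)
qed

lemma tail_tendsto_zero:
  fixes \<nu> :: "'x :: real_normed_vector measure"
  assumes \<nu>: "prob_space \<nu>" "sets \<nu> = sets borel" and "0 < e"
  obtains s where "1 \<le> s" "measure \<nu> {u. s < norm u} \<le> e"
proof -
  interpret \<nu>: prob_space \<nu> by (rule \<nu>)
  have [simp]: "space \<nu> = UNIV" using sets_eq_imp_space_eq[OF \<nu>(2)] by simp
  have "(\<lambda>n. measure \<nu> {u. real n < norm u}) \<longlonglongrightarrow> measure \<nu> (\<Inter>n. {u. real n < norm u})"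
  proof (rule \<nu>.finite_Lim_measure_decseq)
    show "range (\<lambda>n. {u. real n < norm u}) \<subseteq> sets \<nu>" unfolding \<nu>(2) by auto measurable
    show "decseq (\<lambda>n. {u. real n < norm u})" by (auto simp: decseq_def)
  qed
  also have "(\<Inter>n. {u :: 'x. real n < norm u}) = {}"
    by (auto simp: not_less) (meson not_less real_arch_simple)
  finally have "\<forall>\<^sub>F n in sequentially. measure \<nu> {u. real n < norm u} < e"
    using \<open>0 < e\<close> by (auto intro: order_tendstoD)
  then obtain n where "\<And>m. n \<le> m \<Longrightarrow> measure \<nu> {u. real m < norm u} < e"
    by (auto simp: eventually_sequentially)
  \<comment> \<open>The successor guarantees a radius of at least 1.\<close>
  from this[of "Suc n"] show ?thesis by (intro that[of "real (Suc n)"]) auto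
qed

text \<open>The radii solve \<open>t (Suc n) = s + sqrt 2 * t n\<close>, so that the tail step squares the tail
  probability each time \<open>(t n)\<^sup>2\<close> roughly doubles.\<close>

theorem fernique:
  fixes \<nu> :: "'x :: {real_normed_vector, second_countable_topology} measure"
  assumes \<nu>: "prob_space \<nu>" "sets \<nu> = sets borel"
    and rot: "distr (\<nu> \<Otimes>\<^sub>M \<nu>) borel rotate_pair = \<nu> \<Otimes>\<^sub>M \<nu>"
  obtains a where "0 < a" "integrable \<nu> (\<lambda>u. exp (a * (norm u)\<^sup>2))"
proof -
  interpret \<nu>: prob_space \<nu> by (rule \<nu>)
  have [simp]: "space \<nu> = UNIV" using sets_eq_imp_space_eq[OF \<nu>(2)] by simp
  have gt[simp]: "{u. r < norm u} \<in> sets \<nu>" for r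
    unfolding \<nu>(2) by (intro borel_open open_Collect_less continuous_intros)
  \<comment> \<open>A tail of at most 1/4 makes \<open>\<theta>\<close> at least 3/4, so the initial
    ratio \<open>(1 - \<theta>) / \<theta>\<close> is at most 1/3.\<close>
  obtain s where s: "1 \<le> s" "measure \<nu> {u. s < norm u} \<le> 1 / 4"
    using tail_tendsto_zero[OF \<nu>, of "1/4"] by auto
  define \<theta> where "\<theta> = measure \<nu> {u. norm u \<le> s}"
  have tail_s: "measure \<nu> {u. s < norm u} = 1 - \<theta>"
  proof -
    have "{u. norm u \<le> s} = space \<nu> - {u. s < norm u}" by auto
    then show ?thesis unfolding \<theta>_def by (simp only: \<nu>.prob_compl[OF gt])
  qed
  have \<theta>: "3 / 4 \<le> \<theta>" "\<theta> \<le> 1" using s(2) tail_s by (auto simp: \<theta>_def)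
  \<comment> \<open>\<open>- B\<close> is the fixed point of
    \<open>x \<mapsto> s + sqrt 2 * x\<close>, as \<open>1 / (sqrt 2 - 1) = sqrt 2 + 1\<close>, and
    \<open>A = s + B\<close> makes \<open>t 0 = s\<close>.\<close>
  define A B where "A = s * (sqrt 2 + 2)" and "B = s * (sqrt 2 + 1)"
  define t where "t n = A * sqrt 2 ^ n - B" for n
  have A: "0 < A" and B: "0 < B" using s by (simp_all add: A_def B_def add_pos_pos)
  have t0: "t 0 = s" by (simp add: t_def A_def B_def algebra_simps)
  have tSuc: "t (Suc n) = s + sqrt 2 * t n" for n
    by (simp add: t_def A_def B_def algebra_simps)
  \<comment> \<open>Keeping the factor \<open>\<theta>\<close> in the bound lets it cancel the
    \<open>\<theta>\<close> on the left of the tail step.\<close>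
  have tail: "measure \<nu> {u. t n < norm u} \<le> \<theta> * (1 / 3) ^ (2 ^ n)" for n
  proof (induction n)
    case 0
    then show ?case using \<theta> tail_s t0 by simp
  next
    case (Suc n)
    have "\<theta> * measure \<nu> {u. t (Suc n) < norm u} \<le> (measure \<nu> {u. t n < norm u})\<^sup>2"
      unfolding \<theta>_def tSuc by (rule fernique_tail_step[OF \<nu> rot])
    also have "\<dots> \<le> (\<theta> * (1 / 3) ^ (2 ^ n))\<^sup>2"
      by (intro power_mono Suc) simp
    also have "\<dots> = \<theta> * (\<theta> * (1 / 3) ^ (2 ^ Suc n))"
      by (simp add: power2_eq_square power_mult_distrib mult_2 power_add)
    finally show ?case using \<theta> by simp
  qed
  \<comment> \<open>Chosen so that the integrand is at most \<open>(3 / 2) ^ (2 ^ n)\<close> on the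
    shell between \<open>t n\<close> and \<open>t (Suc n)\<close>. Against the tail
    \<open>(1 / 3) ^ (2 ^ n)\<close> this leaves \<open>(1 / 2) ^ (2 ^ n)\<close>, which is
    summable.\<close>
  define a where "a = ln (3 / 2) / (2 * A\<^sup>2)"
  have a: "0 < a" using A by (simp add: a_def)
  have exp_t: "exp (a * (t (Suc n))\<^sup>2) \<le> (3 / 2) ^ (2 ^ n)" for n
  proof -
    have "1 \<le> sqrt 2 ^ Suc n" by (rule one_le_power) simp
    moreover have "B \<le> A" using s by (simp add: A_def B_def)
    moreover have "A * 1 \<le> A * sqrt 2 ^ Suc n"
      using A calculation(1) by (intro mult_left_mono) auto
    ultimately have "B \<le> A * sqrt 2 ^ Suc n" by linarith
    then have "(t (Suc n))\<^sup>2 \<le> (A * sqrt 2 ^ Suc n)\<^sup>2"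
      unfolding t_def using B by (intro power_mono) auto
    also have "(sqrt 2 ^ Suc n)\<^sup>2 = (sqrt 2)\<^sup>2 ^ Suc n"
      by (simp only: power_mult[symmetric] mult.commute)
    then have "(A * sqrt 2 ^ Suc n)\<^sup>2 = 2 * A\<^sup>2 * 2 ^ n"
      by (simp add: power_mult_distrib)
    finally have "a * (t (Suc n))\<^sup>2 \<le> a * (2 * A\<^sup>2 * 2 ^ n)"
      using a by (intro mult_left_mono) auto
    also have "\<dots> = ln (3 / 2) * 2 ^ n" using A by (simp add: a_def)
    also have "\<dots> = real (2 ^ n) * ln (3 / 2)" by simp
    finally have "exp (a * (t (Suc n))\<^sup>2) \<le> exp (real (2 ^ n) * ln (3 / 2))" by simp
    also have "\<dots> = (3 / 2) ^ (2 ^ n)" by (subst exp_of_nat_mult) simp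
    finally show ?thesis .
  qed
  have term_le: "f k \<le> (\<Sum>n. f n)" for f :: "nat \<Rightarrow> ennreal" and k
    using sum_le_suminf[of f "{k}"] by simp
  have shells: "ennreal (exp (a * (norm u)\<^sup>2)) \<le> ennreal (exp (a * s\<^sup>2)) +
      (\<Sum>n. ennreal (exp (a * (t (Suc n))\<^sup>2)) * indicator {u. t n < norm u} u)" for u :: 'x
  proof (cases "norm u \<le> s")
    case True
    then have "ennreal (exp (a * (norm u)\<^sup>2)) \<le> ennreal (exp (a * s\<^sup>2))"
      using a by (intro ennreal_leI) (simp add: power_mono)
    then show ?thesis by (rule order.trans) simp
  next
    case False
    obtain m where "(norm u + B) / A < sqrt 2 ^ m"
      using real_arch_pow[of "sqrt 2"] by auto
    then have "norm u \<le> t m" using A by (simp add: t_def field_simps)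
    \<comment> \<open>The least such \<open>n\<close> identifies the shell of \<open>u\<close>; the
      single term of the series belonging to that shell dominates.\<close>
    define n where "n = (LEAST n. norm u \<le> t n)"
    have n: "norm u \<le> t n" unfolding n_def by (rule LeastI) fact
    with False t0 have "n \<noteq> 0" by (intro notI) simp
    then obtain k where k: "n = Suc k" by (auto simp: gr0_conv_Suc)
    then have "t k < norm u" using not_less_Least[of k "\<lambda>n. norm u \<le> t n"] by (simp add: n_def not_le)
    then have "ennreal (exp (a * (norm u)\<^sup>2)) \<le> ennreal (exp (a * (t (Suc k))\<^sup>2)) * indicator {u. t k < norm u} u"
      using a n k by (auto intro!: ennreal_leI power_mono)
    also have "\<dots> \<le> (\<Sum>n. ennreal (exp (a * (t (Suc n))\<^sup>2)) * indicator {u. t n < norm u} u)"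
      by (rule term_le[of "\<lambda>n. ennreal (exp (a * (t (Suc n))\<^sup>2)) * indicator {u. t n < norm u} u"])
    finally show ?thesis by (rule order.trans) simp
  qed
  have "(\<integral>\<^sup>+u. ennreal (exp (a * (norm u)\<^sup>2)) \<partial>\<nu>) \<le> (\<integral>\<^sup>+u. (ennreal (exp (a * s\<^sup>2)) +
      (\<Sum>n. ennreal (exp (a * (t (Suc n))\<^sup>2)) * indicator {u. t n < norm u} u)) \<partial>\<nu>)"
    by (intro nn_integral_mono shells)
  also have "\<dots> = ennreal (exp (a * s\<^sup>2)) + (\<Sum>n. ennreal (exp (a * (t (Suc n))\<^sup>2)) * emeasure \<nu> {u. t n < norm u})"
  proof (subst nn_integral_add)
    have [measurable]: "(\<lambda>u. indicator {u. t n < norm u} u :: ennreal) \<in> borel_measurable \<nu>" for n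
      by (rule borel_measurable_indicator) simp
    show "(\<lambda>u. \<Sum>n. ennreal (exp (a * (t (Suc n))\<^sup>2)) * indicator {u. t n < norm u} u) \<in> borel_measurable \<nu>"
      by measurable
    show "(\<integral>\<^sup>+u. ennreal (exp (a * s\<^sup>2)) \<partial>\<nu>) +
        (\<integral>\<^sup>+u. (\<Sum>n. ennreal (exp (a * (t (Suc n))\<^sup>2)) * indicator {u. t n < norm u} u) \<partial>\<nu>) =
      ennreal (exp (a * s\<^sup>2)) + (\<Sum>n. ennreal (exp (a * (t (Suc n))\<^sup>2)) * emeasure \<nu> {u. t n < norm u})"
      using \<nu>.emeasure_space_1 by (simp add: nn_integral_suminf nn_integral_cmult_indicator)
  qed simp
  also have "\<dots> \<le> ennreal (exp (a * s\<^sup>2)) + (\<Sum>n. ennreal ((1 / 2) ^ n))"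
  proof (intro add_left_mono suminf_le)
    fix n
    have "exp (a * (t (Suc n))\<^sup>2) * measure \<nu> {u. t n < norm u} \<le> (3 / 2) ^ (2 ^ n) * (1 * (1 / 3) ^ (2 ^ n))"
      using \<theta> by (intro mult_mono exp_t order.trans[OF tail] mult_right_mono) auto
    also have "\<dots> = (1 / 2) ^ (2 ^ n)" by (simp flip: power_mult_distrib)
    also have "\<dots> \<le> (1 / 2) ^ n" by (intro power_decreasing) (auto intro: less_imp_le less_exp)
    finally show "ennreal (exp (a * (t (Suc n))\<^sup>2)) * emeasure \<nu> {u. t n < norm u} \<le> ennreal ((1 / 2) ^ n)"
      by (simp add: \<nu>.emeasure_eq_measure ennreal_leI flip: ennreal_mult)
  qed auto
  also have "\<dots> < \<infinity>"
    by (simp add: suminf_ennreal2 summable_geometric ennreal_add_less_top)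
  finally have fin: "(\<integral>\<^sup>+u. ennreal (exp (a * (norm u)\<^sup>2)) \<partial>\<nu>) < \<infinity>" .
  have "(\<lambda>u. exp (a * (norm u)\<^sup>2)) \<in> borel_measurable \<nu>"
    unfolding measurable_cong_sets[OF \<nu>(2) refl] by measurable
  with fin have "integrable \<nu> (\<lambda>u. exp (a * (norm u)\<^sup>2))"
    by (intro integrableI_nonneg) auto
  with a show ?thesis by (rule that)
qed

section \<open>Perturbation of Gibbs measures\<close>

text \<open>From \<open>ln x \<le> x\<close> and completing the square in \<open>p * x\<close>. It
  bounds all powers of the norm by a multiple of the weight used below.\<close>

lemma powr_le_exp_square:
  fixes c p :: real
  assumes "0 < c" "0 < p" "0 \<le> x"
  shows "x powr p \<le> exp (p\<^sup>2 / (4 * c)) * exp (c * x\<^sup>2)"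
proof (cases "x = 0")
  case False
  then have x: "0 < x" using assms by simp
  have "p * ln x \<le> p * x"
    using assms x by (intro mult_left_mono) (auto intro: less_imp_le ln_less_self)
  also have "\<dots> \<le> p\<^sup>2 / (4 * c) + c * x\<^sup>2"
  proof -
    have "0 \<le> (p - 2 * c * x)\<^sup>2 / (4 * c)" using assms by simp
    also have "\<dots> = p\<^sup>2 / (4 * c) + c * x\<^sup>2 - p * x"
      using assms by (simp add: power2_eq_square field_simps)
    finally show ?thesis by simp
  qed
  finally show ?thesis using x by (simp add: powr_def flip: exp_add)
qed simp

text \<open>After factoring out the larger exponential, \<open>1 - exp (- t) \<le> t\<close>
  remains; the factor is at most \<open>exp (- m)\<close>.\<close>

lemma abs_exp_diff_le:
  fixes x y m :: real
  assumes "m \<le> x" "m \<le> y"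
  shows "\<bar>exp (- x) - exp (- y)\<bar> \<le> exp (- m) * \<bar>x - y\<bar>"
proof -
  have *: "exp (- x) - exp (- y) \<le> exp (- m) * (y - x)" if "m \<le> x" "x \<le> y" for x y :: real
  proof -
    have "exp (- x) - exp (- y) = exp (- x) * (1 - exp (x - y))"
      by (simp add: right_diff_distrib flip: exp_add)
    also have "1 - exp (x - y) \<le> y - x" using exp_ge_add_one_self[of "x - y"] by linarith
    then have "exp (- x) * (1 - exp (x - y)) \<le> exp (- m) * (y - x)"
      using that by (intro mult_mono) auto
    finally show ?thesis .
  qed
  have pos: "exp (- y) \<le> exp (- x)" if "x \<le> y" for x y :: real using that by simp
  show ?thesis
    using *[of x y] *[of y x] pos[of x y] pos[of y x] assms by (cases "x \<le> y") auto
qed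

lemma abs_ln_diff_le:
  fixes x y z :: real
  assumes "0 < z" "z \<le> x" "z \<le> y"
  shows "\<bar>ln x - ln y\<bar> \<le> \<bar>x - y\<bar> / z"
proof -
  have "ln x - ln y \<le> \<bar>x - y\<bar> / z" if "z \<le> x" "z \<le> y" for x y
  proof -
    have "ln x - ln y \<le> (x - y) / y" using that assms(1) by (intro ln_diff_le) auto
    also have "\<dots> \<le> \<bar>x - y\<bar> / z" using that assms(1) by (intro frac_le) auto
    finally show ?thesis .
  qed
  from this[of x y] this[of y x] assms show ?thesis by (auto simp: abs_le_iff abs_minus_commute)
qed

text \<open>\<open>a\<close> is a Fernique exponent. \<open>L\<close> is to bound all potentials on
  the ball of radius \<open>r\<close>, whose mass keeps the partition functions away from 0. The
  constants derived here depend only on these data, hence not on \<open>N\<close>.\<close>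

locale gibbs_reference = prob_space \<nu>
  for \<nu> :: "'x :: {banach, second_countable_topology} measure" +
  fixes a r L :: real
  assumes sets_eq [simp, measurable_cong]: "sets \<nu> = sets borel"
    and a_pos: "0 < a"
    and exp_integrable: "integrable \<nu> (\<lambda>u. exp (a * (norm u)\<^sup>2))"
    and ball_mass: "1 / 2 \<le> measure \<nu> {u. norm u < r}"
begin

text \<open>Half the Fernique exponent, so that a product of two weights is still integrable: one
  controls the difference of potentials, the other the integrand.\<close>

definition weight :: "'x \<Rightarrow> real" where
  "weight u = exp (a / 2 * (norm u)\<^sup>2)"

definition potential :: "('x \<Rightarrow> real) \<Rightarrow> bool" where
  "potential V \<longleftrightarrow> V \<in> borel_measurable borel \<and> (\<forall>u. 0 \<le> V u) \<and> (\<forall>u. norm u < r \<longrightarrow> V u \<le> L)"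

definition partition_function :: "('x \<Rightarrow> real) \<Rightarrow> real" where
  "partition_function V = (\<integral>u. exp (- V u) \<partial>\<nu>)"

definition gibbs_density :: "('x \<Rightarrow> real) \<Rightarrow> 'x \<Rightarrow> real" where
  "gibbs_density V u = exp (- V u) / partition_function V"

text \<open>Lower bound for every partition function: at least half the mass lies where the
  potential is at most \<open>L\<close>.\<close>

abbreviation z :: real where
  "z \<equiv> exp (- L) / 2"

text \<open>Factor by which a bound on the difference of potentials grows under normalisation: 1 for
  the potentials and the rest for the logarithms of the partition functions.\<close>

definition \<kappa> :: real where
  "\<kappa> = 1 + (\<integral>u. weight u \<partial>\<nu>) / z"

definition weight_square_integral :: real where
  "weight_square_integral = (\<integral>u. weight u * weight u \<partial>\<nu>)"

lemma space_eq [simp]: "space \<nu> = UNIV"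
  using sets_eq_imp_space_eq[OF sets_eq] by simp

lemma potential_measurable [measurable]: "potential V \<Longrightarrow> V \<in> borel_measurable borel"
  and potential_nonneg: "potential V \<Longrightarrow> 0 \<le> V u"
  and potential_le: "potential V \<Longrightarrow> norm u < r \<Longrightarrow> V u \<le> L"
  by (auto simp: potential_def)

lemma weight_measurable [measurable]: "weight \<in> borel_measurable borel"
  unfolding weight_def by measurable

lemma weight_ge_1: "1 \<le> weight u"
  using a_pos by (simp add: weight_def)

lemma weight_square: "weight u * weight u = exp (a * (norm u)\<^sup>2)"
  by (simp add: weight_def flip: exp_add)

lemma weight_square_integrable: "integrable \<nu> (\<lambda>u. weight u * weight u)"
  using exp_integrable by (simp only: weight_square)

lemma weight_integrable: "integrable \<nu> weight"
  using weight_square_integrable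
proof (rule Bochner_Integration.integrable_bound)
  show "AE u in \<nu>. norm (weight u) \<le> norm (weight u * weight u)"
  proof (rule AE_I2)
    show "norm (weight u) \<le> norm (weight u * weight u)" for u
      using mult_left_mono[OF weight_ge_1[of u], of "norm (weight u)"] weight_ge_1[of u]
      by (simp add: abs_mult)
  qed
qed measurable

lemma exp_potential_integrable:
  assumes "potential V"
  shows "integrable \<nu> (\<lambda>u. exp (- V u))"
  using assms potential_nonneg[OF assms] by (intro integrable_const_bound[where B = 1]) auto

lemma partition_function_ge:
  assumes V: "potential V"
  shows "z \<le> partition_function V"
proof -
  have "z \<le> exp (- L) * measure \<nu> {u. norm u < r}" using ball_mass by simp
  also have "\<dots> = (\<integral>u. exp (- L) * indicator {u. norm u < r} u \<partial>\<nu>)" by simp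
  also have "\<dots> \<le> partition_function V"
    unfolding partition_function_def
  proof (intro integral_mono exp_potential_integrable V)
    show "exp (- L) * indicator {u. norm u < r} u \<le> exp (- V u)" for u
      using potential_le[OF V, of u] by (auto simp: indicator_def)
  qed (simp add: emeasure_eq_measure)
  finally show ?thesis .
qed

lemma z_pos: "0 < z" by simp

lemma partition_function_pos: "potential V \<Longrightarrow> 0 < partition_function V"
  using partition_function_ge z_pos by (meson less_le_trans)

lemma gibbs_density_measurable [measurable]:
  "potential V \<Longrightarrow> gibbs_density V \<in> borel_measurable borel"
  unfolding gibbs_density_def[abs_def] by measurable

lemma gibbs_density_nonneg: "potential V \<Longrightarrow> 0 \<le> gibbs_density V u"
  by (simp add: gibbs_density_def partition_function_pos less_imp_le)

lemma gibbs_density_le: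
  assumes "potential V"
  shows "gibbs_density V u \<le> 1 / z"
  unfolding gibbs_density_def
  using potential_nonneg[OF assms] partition_function_ge[OF assms] by (intro frac_le) auto

lemma gibbs_density_eq_exp:
  assumes "potential V"
  shows "gibbs_density V u = exp (- (V u + ln (partition_function V)))"
  using partition_function_pos[OF assms] by (simp add: gibbs_density_def exp_minus exp_add exp_diff field_simps)

lemma gibbs_eq: "gibbs \<nu> V = density \<nu> (\<lambda>u. ennreal (gibbs_density V u))"
  by (simp add: gibbs_def gibbs_density_def partition_function_def)

lemma sets_gibbs [simp, measurable_cong]: "sets (gibbs \<nu> V) = sets borel"
  by (simp add: gibbs_eq)

lemma prob_space_gibbs:
  assumes V: "potential V"
  shows "prob_space (gibbs \<nu> V)"
proof (rule prob_spaceI)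
  have "(\<integral>\<^sup>+u. ennreal (gibbs_density V u) \<partial>\<nu>) = ennreal (\<integral>u. gibbs_density V u \<partial>\<nu>)"
    using V exp_potential_integrable[OF V]
    by (intro nn_integral_eq_integral AE_I2 gibbs_density_nonneg) (auto simp: gibbs_density_def)
  also have "(\<integral>u. gibbs_density V u \<partial>\<nu>) = 1"
    using partition_function_pos[OF V] by (simp add: gibbs_density_def flip: partition_function_def)
  finally show "emeasure (gibbs \<nu> V) (space (gibbs \<nu> V)) = 1"
    using V by (simp add: gibbs_eq emeasure_density)
qed

lemma density_mult_integrable:
  fixes g :: "'x \<Rightarrow> 'b :: {banach, second_countable_topology}"
  assumes V: "potential V" and [measurable]: "g \<in> borel_measurable borel"
    and g: "\<And>u. norm (g u) \<le> B * weight u"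
  shows "integrable \<nu> (\<lambda>u. gibbs_density V u *\<^sub>R g u)"
proof (rule Bochner_Integration.integrable_bound)
  show "integrable \<nu> (\<lambda>u. (1 / z) * (B * (weight u * weight u)))"
    by (intro integrable_mult_right weight_square_integrable)
  show "AE u in \<nu>. norm (gibbs_density V u *\<^sub>R g u) \<le> norm ((1 / z) * (B * (weight u * weight u)))"
  proof (rule AE_I2)
    fix u
    \<comment> \<open>No sign of \<open>B\<close> is assumed; it follows from the bound on
      \<open>g\<close>. Then one more weight, being at least 1, can be multiplied in.\<close>
    have "0 \<le> B * weight u" using g[of u] norm_ge_zero order.trans by blast
    then have "B * weight u \<le> B * weight u * weight u"
      using weight_ge_1[of u] by (simp add: mult_le_cancel_left1)
    with g[of u] have "norm (g u) \<le> B * (weight u * weight u)" by (simp add: mult.assoc)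
    moreover have "\<bar>gibbs_density V u\<bar> \<le> 1 / z"
      using gibbs_density_nonneg[OF V] gibbs_density_le[OF V] by simp
    ultimately have "norm (gibbs_density V u *\<^sub>R g u) \<le> (1 / z) * (B * (weight u * weight u))"
      unfolding norm_scaleR by (intro mult_mono) auto
    then show "norm (gibbs_density V u *\<^sub>R g u) \<le> norm ((1 / z) * (B * (weight u * weight u)))"
      by (rule order.trans) (simp only: real_norm_def abs_ge_self)
  qed
qed (use V in measurable)

lemma
  fixes g :: "'x \<Rightarrow> 'b :: {banach, second_countable_topology}"
  assumes V: "potential V" and [measurable]: "g \<in> borel_measurable borel"
    and g: "\<And>u. norm (g u) \<le> B * weight u"
  shows integrable_gibbs: "integrable (gibbs \<nu> V) g"
    and integral_gibbs: "(\<integral>u. g u \<partial>gibbs \<nu> V) = (\<integral>u. gibbs_density V u *\<^sub>R g u \<partial>\<nu>)"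
  unfolding gibbs_eq using V density_mult_integrable[OF V _ g]
  by (auto simp: integrable_density integral_density gibbs_density_nonneg)

lemma weight_integral_nonneg: "0 \<le> (\<integral>u. weight u \<partial>\<nu>)"
  using weight_ge_1 by (intro integral_nonneg_AE AE_I2) (meson order.trans zero_le_one)

lemma \<kappa>_nonneg: "0 \<le> \<kappa>"
  using weight_integral_nonneg by (simp add: \<kappa>_def)

lemma weight_square_integral_nonneg: "0 \<le> weight_square_integral"
  unfolding weight_square_integral_def by (intro integral_nonneg_AE AE_I2) (simp only: weight_square exp_ge_zero)

text \<open>A Gibbs density and its square root are exponentials of the potential shifted by \<open>ln Z\<close>, so both
  the total variation and the Hellinger estimate reduce to the difference of the shifted potentials.\<close>

lemma normalized_potential_diff_le:
  assumes V: "potential V" and W: "potential W"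
    and close: "\<And>u. \<bar>V u - W u\<bar> \<le> \<delta> * weight u"
  shows "\<bar>(V u + ln (partition_function V)) - (W u + ln (partition_function W))\<bar>
    \<le> \<kappa> * \<delta> * weight u"
proof -
  have "0 \<le> \<delta> * weight u" using close[of u] abs_ge_zero order.trans by blast
  then have \<delta>: "0 \<le> \<delta>" using weight_ge_1[of u] by (simp add: zero_le_mult_iff)
  have "\<bar>partition_function V - partition_function W\<bar> = \<bar>\<integral>u. exp (- V u) - exp (- W u) \<partial>\<nu>\<bar>"
    using exp_potential_integrable V W by (simp add: partition_function_def)
  also have "\<dots> \<le> (\<integral>u. \<delta> * weight u \<partial>\<nu>)"
  proof (rule norm_integral_le_integral[where 'b=real, unfolded real_norm_def])
    show "\<bar>exp (- V u) - exp (- W u)\<bar> \<le> \<delta> * weight u" for u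
      using abs_exp_diff_le[of 0 "V u" "W u"] potential_nonneg[OF V] potential_nonneg[OF W] close[of u] by simp
  qed (simp add: weight_integrable)
  finally have "\<bar>partition_function V - partition_function W\<bar> / z \<le> \<delta> * (\<integral>u. weight u \<partial>\<nu>) / z"
    by (intro divide_right_mono) auto
  moreover have "\<bar>ln (partition_function V) - ln (partition_function W)\<bar> \<le>
      \<bar>partition_function V - partition_function W\<bar> / z"
    by (intro abs_ln_diff_le z_pos partition_function_ge V W)
  moreover have "\<delta> * (\<integral>u. weight u \<partial>\<nu>) / z \<le> \<delta> * (\<integral>u. weight u \<partial>\<nu>) / z * weight u"
    using mult_left_mono[OF weight_ge_1[of u], of "\<delta> * (\<integral>u. weight u \<partial>\<nu>) / z"] \<delta> weight_integral_nonneg by simp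
  ultimately have "\<bar>(V u + ln (partition_function V)) - (W u + ln (partition_function W))\<bar>
      \<le> \<delta> * weight u + \<delta> * (\<integral>u. weight u \<partial>\<nu>) / z * weight u"
    using close[of u] by linarith
  also have "\<dots> = \<kappa> * \<delta> * weight u" by (simp add: \<kappa>_def algebra_simps)
  finally show ?thesis .
qed

text \<open>This uniform lower bound for the shifted potentials is the \<open>m\<close> at which
  \<open>abs_exp_diff_le\<close> is applied.\<close>

lemma ln_z_le: "potential V \<Longrightarrow> ln z \<le> V u + ln (partition_function V)"
  using potential_nonneg[of V u] partition_function_ge[of V] partition_function_pos[of V] z_pos
  by (smt (verit) ln_le_cancel_iff)

text \<open>The difference of the densities is at most \<open>\<kappa> / z * \<delta>\<close> times
  one weight, and \<open>g\<close> contributes the second. With values in a Banach space, this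
  treats moments, means and second moments alike.\<close>

theorem integral_gibbs_diff_le:
  fixes g :: "'x \<Rightarrow> 'b :: {banach, second_countable_topology}"
  assumes V: "potential V" and W: "potential W"
    and close: "\<And>u. \<bar>V u - W u\<bar> \<le> \<delta> * weight u"
    and g_meas: "g \<in> borel_measurable borel" and g: "\<And>u. norm (g u) \<le> B * weight u"
  shows "norm ((\<integral>u. g u \<partial>gibbs \<nu> V) - (\<integral>u. g u \<partial>gibbs \<nu> W)) \<le> \<kappa> * weight_square_integral / z * B * \<delta>"
proof -
  have "(\<integral>u. g u \<partial>gibbs \<nu> V) - (\<integral>u. g u \<partial>gibbs \<nu> W) =
      (\<integral>u. (gibbs_density V u - gibbs_density W u) *\<^sub>R g u \<partial>\<nu>)"
    using density_mult_integrable[OF V g_meas g] density_mult_integrable[OF W g_meas g]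
    by (simp add: integral_gibbs[OF V g_meas g] integral_gibbs[OF W g_meas g] scaleR_diff_left)
  also have "norm \<dots> \<le> (\<integral>u. \<kappa> / z * B * \<delta> * (weight u * weight u) \<partial>\<nu>)"
  proof (rule norm_integral_le_integral)
    fix u
    have "\<bar>gibbs_density V u - gibbs_density W u\<bar> \<le> exp (- ln z) *
        \<bar>(V u + ln (partition_function V)) - (W u + ln (partition_function W))\<bar>"
      unfolding gibbs_density_eq_exp[OF V] gibbs_density_eq_exp[OF W]
      by (intro abs_exp_diff_le ln_z_le V W)
    also have "\<dots> \<le> exp (- ln z) * (\<kappa> * \<delta> * weight u)"
      by (intro mult_left_mono normalized_potential_diff_le V W close) simp
    also have "\<dots> = \<kappa> / z * \<delta> * weight u"
      by (simp only: exp_minus exp_ln[OF z_pos]) (simp add: field_simps)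
    finally have "norm ((gibbs_density V u - gibbs_density W u) *\<^sub>R g u) \<le> (\<kappa> / z * \<delta> * weight u) * (B * weight u)"
      unfolding norm_scaleR using g[of u] by (intro mult_mono) auto
    then show "norm ((gibbs_density V u - gibbs_density W u) *\<^sub>R g u) \<le> \<kappa> / z * B * \<delta> * (weight u * weight u)"
      by (simp add: mult_ac)
  qed (intro integrable_mult_right weight_square_integrable)
  also have "\<dots> = \<kappa> * weight_square_integral / z * B * \<delta>" by (simp add: weight_square_integral_def)
  finally show ?thesis .
qed

text \<open>Uniqueness of densities up to null sets replaces the abstract derivative in
  \<open>hellinger\<close> by the explicit density.\<close>

lemma RN_deriv_gibbs:
  assumes V: "potential V"
  shows "AE u in \<nu>. enn2real (RN_deriv \<nu> (gibbs \<nu> V) u) = gibbs_density V u"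
proof -
  have "AE u in \<nu>. ennreal (gibbs_density V u) = RN_deriv \<nu> (gibbs \<nu> V) u"
    using V by (intro RN_deriv_unique) (auto simp: gibbs_eq)
  then show ?thesis
    by eventually_elim (metis V enn2real_ennreal gibbs_density_nonneg)
qed

text \<open>The square root of a Gibbs density is the exponential of minus half the shifted
  potential, so the Lipschitz bound for exponentials applies with lower bound
  \<open>ln z / 2\<close>. Squaring gives two weights, which are integrable.\<close>

theorem hellinger_gibbs_le:
  assumes V: "potential V" and W: "potential W"
    and close: "\<And>u. \<bar>V u - W u\<bar> \<le> \<delta> * weight u"
  shows "hellinger \<nu> (gibbs \<nu> V) (gibbs \<nu> W) \<le> exp (- (ln z / 2)) * \<kappa> / 2 * sqrt weight_square_integral * \<delta>"
proof -
  define c where "c = exp (- (ln z / 2)) * \<kappa> / 2"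
  have c: "0 \<le> c" using \<kappa>_nonneg by (simp add: c_def)
  have "0 \<le> \<delta> * weight 0" using close[of 0] abs_ge_zero order.trans by blast
  then have \<delta>: "0 \<le> \<delta>" using weight_ge_1[of 0] by (simp add: zero_le_mult_iff)
  have sqrt_density: "sqrt (gibbs_density V u) = exp (- ((V u + ln (partition_function V)) / 2))"
    if "potential V" for V u
    unfolding gibbs_density_eq_exp[OF that]
    by (rule real_sqrt_unique) (simp_all add: power2_eq_square flip: exp_add)
  have "(\<integral>u. (sqrt (enn2real (RN_deriv \<nu> (gibbs \<nu> V) u)) - sqrt (enn2real (RN_deriv \<nu> (gibbs \<nu> W) u)))\<^sup>2 \<partial>\<nu>)
      = (\<integral>u. (sqrt (gibbs_density V u) - sqrt (gibbs_density W u))\<^sup>2 \<partial>\<nu>)"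
  proof (rule integral_cong_AE)
    show "AE u in \<nu>. (sqrt (enn2real (RN_deriv \<nu> (gibbs \<nu> V) u)) - sqrt (enn2real (RN_deriv \<nu> (gibbs \<nu> W) u)))\<^sup>2
        = (sqrt (gibbs_density V u) - sqrt (gibbs_density W u))\<^sup>2"
      using RN_deriv_gibbs[OF V] RN_deriv_gibbs[OF W] by eventually_elim simp
  qed (use V W in measurable)
  also have "\<dots> \<le> (\<integral>u. (c * \<delta>)\<^sup>2 * (weight u * weight u) \<partial>\<nu>)"
  proof (rule integral_mono')
    fix u
    have "\<bar>sqrt (gibbs_density V u) - sqrt (gibbs_density W u)\<bar> \<le> exp (- (ln z / 2)) *
        \<bar>(V u + ln (partition_function V)) / 2 - (W u + ln (partition_function W)) / 2\<bar>"
      unfolding sqrt_density[OF V] sqrt_density[OF W]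
      by (intro abs_exp_diff_le divide_right_mono ln_z_le V W) auto
    also have "\<dots> = exp (- (ln z / 2)) / 2 *
        \<bar>(V u + ln (partition_function V)) - (W u + ln (partition_function W))\<bar>"
      by (simp flip: diff_divide_distrib)
    also have "\<dots> \<le> exp (- (ln z / 2)) / 2 * (\<kappa> * \<delta> * weight u)"
      by (intro mult_left_mono normalized_potential_diff_le V W close) simp
    also have "\<dots> = c * \<delta> * weight u" by (simp add: c_def)
    finally have "(sqrt (gibbs_density V u) - sqrt (gibbs_density W u))\<^sup>2 \<le> (c * \<delta> * weight u)\<^sup>2"
      by (rule abs_le_square_iff[THEN iffD1, OF order.trans]) simp
    then show "(sqrt (gibbs_density V u) - sqrt (gibbs_density W u))\<^sup>2 \<le> (c * \<delta>)\<^sup>2 * (weight u * weight u)"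
      by (simp only: power_mult_distrib power2_eq_square[of "weight u"])
  qed (auto intro: weight_square_integrable)
  also have "\<dots> = (c * \<delta>)\<^sup>2 * weight_square_integral" by (simp add: weight_square_integral_def)
  finally have "hellinger \<nu> (gibbs \<nu> V) (gibbs \<nu> W) \<le> sqrt (1 / 2 * ((c * \<delta>)\<^sup>2 * weight_square_integral))"
    unfolding hellinger_def by (intro real_sqrt_le_mono mult_left_mono) auto
  \<comment> \<open>The factor 1/2 in the Hellinger distance is bounded by 1.\<close>
  also have "\<dots> \<le> sqrt ((c * \<delta>)\<^sup>2 * weight_square_integral)" using weight_square_integral_nonneg by (intro real_sqrt_le_mono) simp
  also have "\<dots> = c * sqrt weight_square_integral * \<delta>" using c \<delta> by (simp add: real_sqrt_mult)
  finally show ?thesis unfolding c_def .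
qed

end

section \<open>Inner products inducing the norm, and covariance operators\<close>

lemma inner_product_of_norm_Cauchy_Schwarz:
  assumes ip: "inner_product_of_norm ip"
  shows "\<bar>ip x y\<bar> \<le> norm x * norm y"
proof (cases "y = 0")
  case True
  have "bilinear ip" using ip by (simp add: inner_product_of_norm_def)
  then show ?thesis using True by (simp add: bilinear_rzero)
next
  case False
  have bil: "bilinear ip" and sym: "\<And>x y. ip x y = ip y x" and sq: "\<And>x. ip x x = (norm x)\<^sup>2"
    using ip by (auto simp: inner_product_of_norm_def)
  \<comment> \<open>The minimiser of the quadratic polynomial
    \<open>t \<mapsto> (norm (x + t *\<^sub>R y))\<^sup>2\<close>.\<close>
  define t where "t = - ip x y / (norm y)\<^sup>2"
  have "0 \<le> (norm (x + t *\<^sub>R y))\<^sup>2" by simp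
  also have "\<dots> = (norm x)\<^sup>2 + 2 * t * ip x y + t\<^sup>2 * (norm y)\<^sup>2"
    unfolding sq[symmetric]
    by (simp add: bilinear_ladd[OF bil] bilinear_radd[OF bil] bilinear_lmul[OF bil] bilinear_rmul[OF bil]
        sym[of y x] power2_eq_square algebra_simps)
  also have "\<dots> = (norm x)\<^sup>2 - (ip x y)\<^sup>2 / (norm y)\<^sup>2"
    using False by (simp add: t_def power2_eq_square field_simps)
  finally have "(ip x y)\<^sup>2 \<le> (norm x * norm y)\<^sup>2"
    using False by (simp add: power_mult_distrib field_simps)
  then show ?thesis by (simp add: abs_le_square_iff[symmetric] abs_mult)
qed

lemma inner_product_of_norm_bounded_bilinear:
  assumes ip: "inner_product_of_norm ip"
  shows "bounded_bilinear ip"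
proof
  have bil: "bilinear ip" using ip by (simp add: inner_product_of_norm_def)
  show "ip (x + x') y = ip x y + ip x' y" "ip x (y + y') = ip x y + ip x y'"
    "ip (r *\<^sub>R x) y = r *\<^sub>R ip x y" "ip x (r *\<^sub>R y) = r *\<^sub>R ip x y" for x x' y y' r
    by (simp_all add: bilinear_ladd[OF bil] bilinear_radd[OF bil] bilinear_lmul[OF bil] bilinear_rmul[OF bil])
  show "\<exists>K. \<forall>x y. norm (ip x y) \<le> norm x * norm y * K"
    using inner_product_of_norm_Cauchy_Schwarz[OF ip] by (intro exI[of _ 1]) simp
qed

context
  fixes M :: "'x :: {banach, second_countable_topology} measure"
    and ip :: "'x \<Rightarrow> 'x \<Rightarrow> real"
  assumes M: "prob_space M" and sets_M [simp, measurable_cong]: "sets M = sets borel"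
    and moment1: "integrable M (\<lambda>u. u)" and moment2: "integrable M (\<lambda>u. (norm u)\<^sup>2)"
    and ip: "inner_product_of_norm ip"
begin

interpretation prob_space M by (rule M)
interpretation ip: bounded_bilinear ip by (rule inner_product_of_norm_bounded_bilinear[OF ip])

lemma norm_second_moment_integrand_le: "norm (ip u h *\<^sub>R u) \<le> (norm u)\<^sup>2 * norm h"
  using mult_right_mono[OF inner_product_of_norm_Cauchy_Schwarz[OF ip, of u h] norm_ge_zero[of u]]
  by (simp add: power2_eq_square mult_ac)

lemma second_moment_integrand_measurable: "(\<lambda>u. ip u h *\<^sub>R u) \<in> borel_measurable borel"
  by (intro borel_measurable_continuous_onI continuous_intros
      linear_continuous_on[OF ip.bounded_linear_left])

lemma second_moment_integrable: "integrable M (\<lambda>u. ip u h *\<^sub>R u)"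
proof (rule Bochner_Integration.integrable_bound)
  show "integrable M (\<lambda>u. (norm u)\<^sup>2 * norm h)" using moment2 by simp
  show "(\<lambda>u. ip u h *\<^sub>R u) \<in> borel_measurable M"
    using second_moment_integrand_measurable by (simp cong: measurable_cong_sets)
qed (use norm_second_moment_integrand_le in \<open>auto intro!: AE_I2\<close>)

text \<open>Expanding the centred integrand leaves a second moment whose integrand no longer
  involves the mean. Two measures can then be compared through the integral of one fixed function
  and through their means.\<close>

lemma covariance_operator_eq:
  "covariance_operator ip M h = (\<integral>u. ip u h *\<^sub>R u \<partial>M) - ip (mean M) h *\<^sub>R mean M"
proof -
  let ?m = "mean M"
  have int_ip: "integrable M (\<lambda>u. ip u h)" and ip_mean: "(\<integral>u. ip u h \<partial>M) = ip ?m h"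
    using integrable_bounded_linear[OF ip.bounded_linear_left moment1]
      integral_bounded_linear[OF ip.bounded_linear_left moment1] by (simp_all add: mean_def)
  have "covariance_operator ip M h =
      (\<integral>u. ip u h *\<^sub>R u - ip u h *\<^sub>R ?m - ip ?m h *\<^sub>R u + ip ?m h *\<^sub>R ?m \<partial>M)"
    unfolding covariance_operator_def
    by (intro Bochner_Integration.integral_cong refl) (simp add: ip.diff_left algebra_simps)
  also have "\<dots> = (\<integral>u. ip u h *\<^sub>R u \<partial>M) - ip ?m h *\<^sub>R ?m - ip ?m h *\<^sub>R (\<integral>u. u \<partial>M) + ip ?m h *\<^sub>R ?m"
    using second_moment_integrable[of h] int_ip moment1 by (simp add: ip_mean prob_space)
  also have "(\<integral>u. u \<partial>M) = ?m" by (simp add: mean_def)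
  finally show ?thesis by simp
qed

text \<open>Boundedness comes from the Cauchy-Schwarz inequality, with the second moment plus the
  squared norm of the mean as constant.\<close>

lemma bounded_linear_covariance_operator: "bounded_linear (covariance_operator ip M)"
proof (rule bounded_linear_intro)
  show "covariance_operator ip M (h + k) = covariance_operator ip M h + covariance_operator ip M k" for h k
    using second_moment_integrable
    by (simp add: covariance_operator_eq ip.add_right scaleR_add_left)
  show "covariance_operator ip M (c *\<^sub>R h) = c *\<^sub>R covariance_operator ip M h" for c h
    by (simp add: covariance_operator_eq ip.scaleR_right scaleR_diff_right flip: scaleR_scaleR)
  show "norm (covariance_operator ip M h) \<le> norm h * ((\<integral>u. (norm u)\<^sup>2 \<partial>M) + (norm (mean M))\<^sup>2)" for h
  proof -
    have "norm (\<integral>u. ip u h *\<^sub>R u \<partial>M) \<le> (\<integral>u. (norm u)\<^sup>2 * norm h \<partial>M)"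
      using moment2 norm_second_moment_integrand_le by (intro norm_integral_le_integral) auto
    then show ?thesis
      using norm_second_moment_integrand_le[of "mean M" h]
        norm_triangle_ineq4[of "\<integral>u. ip u h *\<^sub>R u \<partial>M" "ip (mean M) h *\<^sub>R mean M"]
      unfolding covariance_operator_eq by (simp add: algebra_simps)
  qed
qed

end

section \<open>Measures regarded on a subspace\<close>

lemma prob_space_regarded_on:
  assumes "regarded_on j \<mu> \<nu>" "emeasure \<mu> (range j) = 1"
  shows "prob_space \<nu>"
proof (rule prob_spaceI)
  have "space \<nu> = UNIV"
    using assms(1) sets_eq_imp_space_eq[of \<nu> borel] by (simp add: regarded_on_def)
  then show "emeasure \<nu> (space \<nu>) = 1"
    using assms by (simp add: regarded_on_def)
qed

text \<open>Since \<open>emeasure\<close> vanishes outside the sigma-algebra, full mass of \<open>range j\<close> already makes it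
  measurable, and the image of a preimage under \<open>j\<close> needs no Lusin-Souslin theorem.\<close>

lemma distr_regarded_on:
  fixes j :: "'x :: {second_countable_topology, real_normed_vector} \<Rightarrow> 'h :: {second_countable_topology, real_normed_vector}"
  assumes j: "continuous_on UNIV j" and \<mu>: "prob_space \<mu>" "sets \<mu> = sets borel"
    and full: "emeasure \<mu> (range j) = 1" and \<nu>: "regarded_on j \<mu> \<nu>"
  shows "distr \<nu> borel j = \<mu>"
proof (rule measure_eqI)
  interpret \<mu>: prob_space \<mu> by (rule \<mu>)
  have sets_\<nu>: "sets \<nu> = sets borel" using \<nu> by (simp add: regarded_on_def)
  have range: "range j \<in> sets \<mu>" using full emeasure_notin_sets[of "range j" \<mu>] by fastforce
  have j_meas: "j \<in> borel_measurable borel" by (rule borel_measurable_continuous_onI[OF j])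
  fix B assume "B \<in> sets (distr \<nu> borel j)"
  then have B: "B \<in> sets borel" by simp
  have "emeasure (distr \<nu> borel j) B = emeasure \<nu> (j -` B \<inter> space \<nu>)"
    using j_meas B sets_\<nu> by (intro emeasure_distr) (simp_all cong: measurable_cong_sets)
  also have "j -` B \<inter> space \<nu> = j -` B" using sets_eq_imp_space_eq[OF sets_\<nu>] by simp
  also have "emeasure \<nu> (j -` B) = emeasure \<mu> (j ` (j -` B))"
    using \<nu> measurable_sets_borel[OF j_meas B] by (simp add: regarded_on_def)
  also have "j ` (j -` B) = B \<inter> range j" by auto
  also have "emeasure \<mu> (B \<inter> range j) = emeasure \<mu> B"
  proof (rule emeasure_eq_AE)
    have "AE x in \<mu>. x \<in> range j"
      using full range by (intro \<mu>.AE_prob_1) (simp_all add: measure_def)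
    then show "AE x in \<mu>. x \<in> B \<inter> range j \<longleftrightarrow> x \<in> B" by eventually_elim auto
  qed (use B range \<mu>(2) in auto)
  finally show "emeasure (distr \<nu> borel j) B = emeasure \<mu> B" .
qed (use \<mu> in simp)

text \<open>The image of \<open>\<nu>\<close> under \<open>j\<close> is \<open>\<mu>\<close>, so the
  functionals \<open>h \<bullet> j u\<close> have the Gaussian marginals of \<open>\<mu>\<close>.
  This yields rotation invariance and thereby the exponential moment in the stronger norm.\<close>

theorem fernique_regarded_on:
  fixes j :: "'x :: {banach, second_countable_topology}
              \<Rightarrow> 'h :: {real_inner, banach, second_countable_topology}"
  assumes j: "bounded_linear j" "inj j" and gaussian: "centered_gaussian C \<mu>"
    and full: "emeasure \<mu> (range j) = 1" and \<nu>: "regarded_on j \<mu> \<nu>"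
  obtains a where "0 < a" "integrable \<nu> (\<lambda>u. exp (a * (norm u)\<^sup>2))"
proof -
  have C: "bounded_linear C" "\<And>h. 0 \<le> h \<bullet> C h"
    and \<mu>: "prob_space \<mu>" "sets \<mu> = sets borel"
    and marginal: "\<And>h. distr \<mu> borel (\<lambda>u. h \<bullet> u) = centered_normal (sqrt (h \<bullet> C h))"
    using gaussian by (auto simp: centered_gaussian_def)
  have sets_\<nu>: "sets \<nu> = sets borel" using \<nu> by (simp add: regarded_on_def)
  have prob_\<nu>: "prob_space \<nu>" by (rule prob_space_regarded_on[OF \<nu> full])
  have j_cont: "continuous_on UNIV j" using j(1) by (rule linear_continuous_on)
  have j_meas: "j \<in> \<nu> \<rightarrow>\<^sub>M borel"
    using borel_measurable_continuous_onI[OF j_cont] sets_\<nu> by (simp cong: measurable_cong_sets)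
  have "distr \<nu> borel (\<lambda>u. h \<bullet> j u) = centered_normal (sqrt (h \<bullet> C h))" for h
  proof -
    have "distr \<nu> borel (\<lambda>u. h \<bullet> j u) = distr (distr \<nu> borel j) borel (\<lambda>u. h \<bullet> u)"
      using j_meas by (subst distr_distr) (simp_all add: comp_def)
    then show ?thesis by (simp only: distr_regarded_on[OF j_cont \<mu> full \<nu>] marginal)
  qed
  then have "distr (\<nu> \<Otimes>\<^sub>M \<nu>) borel rotate_pair = \<nu> \<Otimes>\<^sub>M \<nu>"
    by (rule rotation_invariant_if_gaussian_functionals[OF j prob_\<nu> sets_\<nu> C])
  then show ?thesis by (rule fernique[OF prob_\<nu> sets_\<nu> _ that])
qed

section \<open>Least-squares potentials and convergence of the perturbed measures\<close>

theorem corollary2p5: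
  fixes j :: "'x :: {banach, second_countable_topology}
              \<Rightarrow> 'h :: {real_inner, banach, second_countable_topology}"
    and \<C> :: "'h \<Rightarrow> 'h"
    and \<mu>H :: "'h measure"
    and \<mu>0 :: "'x measure"
    and y :: "real ^ 'm"
    and \<Gamma> :: "real ^ 'm ^ 'm"
    and G :: "'x \<Rightarrow> real ^ 'm"
    and GN :: "nat \<Rightarrow> 'x \<Rightarrow> real ^ 'm"
    and \<psi> :: "nat \<Rightarrow> real"
    and \<Phi> :: "'x \<Rightarrow> real"
    and \<Phi>N :: "nat \<Rightarrow> 'x \<Rightarrow> real"
    and \<mu> :: "'x measure"
    and \<mu>N :: "nat \<Rightarrow> 'x measure"
  assumes embedding: "bounded_linear j" "inj j"
    and gaussian: "centered_gaussian \<C> \<mu>H"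
    and full_measure: "emeasure \<mu>H (range j) = 1"
    and \<mu>0: "regarded_on j \<mu>H \<mu>0"
    and \<Gamma>: "sym_pos_def \<Gamma>"
    and G_measurable: "G \<in> borel_measurable borel" "\<And>N. GN N \<in> borel_measurable borel"
    and \<Phi>: "\<And>u. \<Phi> u = 1 / 2 * (weighted_norm \<Gamma> (y - G u))\<^sup>2"
    and \<Phi>N: "\<And>N u. \<Phi>N N u = 1 / 2 * (weighted_norm \<Gamma> (y - GN N u))\<^sup>2"
    and approximation: "\<And>\<epsilon>. \<epsilon> > 0 \<Longrightarrow>
          \<exists>K'>0. \<forall>u N. norm (G u - GN N u) \<le> K' * exp (\<epsilon> * (norm u)\<^sup>2) * \<psi> N"
    and \<psi>: "\<psi> \<longlonglongrightarrow> 0"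
    and growth: "\<And>\<epsilon>. \<epsilon> > 0 \<Longrightarrow>
          \<exists>M. \<forall>u N. weighted_norm \<Gamma> (G u) \<le> exp (\<epsilon> * (norm u)\<^sup>2 + M) \<and>
                    weighted_norm \<Gamma> (GN N u) \<le> exp (\<epsilon> * (norm u)\<^sup>2 + M)"
    and \<mu>: "\<mu> = gibbs \<mu>0 \<Phi>"
    and \<mu>N: "\<And>N. \<mu>N N = gibbs \<mu>0 (\<Phi>N N)"
  shows
    "(\<forall>\<epsilon>>0. \<exists>M'. \<forall>u N. \<Phi> u \<ge> M' - \<epsilon> * (norm u)\<^sup>2 \<and> \<Phi>N N u \<ge> M' - \<epsilon> * (norm u)\<^sup>2) \<and>
     (\<forall>r>0. \<exists>L>0. \<forall>u N. norm u < r \<longrightarrow> \<Phi> u \<le> L \<and> \<Phi>N N u \<le> L) \<and>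
     (\<forall>\<epsilon>>0. \<exists>K>0. \<forall>u N. \<bar>\<Phi> u - \<Phi>N N u\<bar> \<le> K * exp (\<epsilon> * (norm u)\<^sup>2) * \<psi> N) \<and>
     prob_space \<mu> \<and> (\<forall>N. prob_space (\<mu>N N)) \<and>
     (\<exists>C. \<forall>N. hellinger \<mu>0 \<mu> (\<mu>N N) \<le> C * \<psi> N) \<and>
     (\<forall>p>0. integrable \<mu> (\<lambda>u. norm u powr p) \<and>
            (\<forall>N. integrable (\<mu>N N) (\<lambda>u. norm u powr p)) \<and>
            (\<exists>C. \<forall>N. \<bar>(\<integral>u. norm u powr p \<partial>\<mu>) - (\<integral>u. norm u powr p \<partial>\<mu>N N)\<bar> \<le> C * \<psi> N)) \<and>
     (integrable \<mu> (\<lambda>u. u) \<and> (\<forall>N. integrable (\<mu>N N) (\<lambda>u. u)) \<and>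
      (\<exists>C. \<forall>N. norm (mean \<mu> - mean (\<mu>N N)) \<le> C * \<psi> N)) \<and>
     (\<forall>ip. inner_product_of_norm ip \<longrightarrow>
        bounded_linear (covariance_operator ip \<mu>) \<and>
        (\<forall>N. bounded_linear (covariance_operator ip (\<mu>N N))) \<and>
        (\<exists>C. \<forall>N. onorm (\<lambda>h. covariance_operator ip \<mu> h - covariance_operator ip (\<mu>N N) h)
                 \<le> C * \<psi> N))"
proof -
  define w where "w = weighted_norm \<Gamma>"
  define S where "S = inv_sqrt_matrix \<Gamma>"
  have w: "w x = norm (S *v x)" for x by (simp add: w_def S_def weighted_norm_def)
  have w_nonneg: "0 \<le> w x" for x by (simp add: w)
  have w_diff: "w (x - x') \<le> w x + w x'" for x x'
    by (simp add: w matrix_vector_mult_diff_distrib norm_triangle_ineq4)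
  have w_rev: "\<bar>w x - w x'\<bar> \<le> w (x - x')" for x x'
    by (simp add: w matrix_vector_mult_diff_distrib norm_triangle_ineq3)
  obtain c where c: "0 < c" "\<And>x. w x \<le> c * norm x"
    using bounded_linear.pos_bounded[OF matrix_vector_mul_bounded_linear[of S]] by (auto simp: w mult.commute)
  have \<Phi>_eq: "\<Phi> u = 1 / 2 * (w (y - G u))\<^sup>2" and \<Phi>N_eq: "\<Phi>N N u = 1 / 2 * (w (y - GN N u))\<^sup>2" for N u
    by (simp_all add: \<Phi> \<Phi>N w_def)
  have growth_w: "\<exists>M. \<forall>u N. w (G u) \<le> exp (\<epsilon> * (norm u)\<^sup>2 + M) \<and> w (GN N u) \<le> exp (\<epsilon> * (norm u)\<^sup>2 + M)"
    if "0 < \<epsilon>" for \<epsilon> using growth[OF that] by (simp add: w_def)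

  \<comment> \<open>Part (a): bounds on the potentials\<close>
  have nonneg: "0 \<le> \<Phi> u" "0 \<le> \<Phi>N N u" for N u by (simp_all add: \<Phi>_eq \<Phi>N_eq)
  have lower: "\<exists>M'. \<forall>u N. \<Phi> u \<ge> M' - \<epsilon> * (norm u)\<^sup>2 \<and> \<Phi>N N u \<ge> M' - \<epsilon> * (norm u)\<^sup>2" if "0 < \<epsilon>" for \<epsilon> :: real
    \<comment> \<open>\<open>M' = 0\<close> serves every \<open>\<epsilon>\<close>, since the
      potentials are nonnegative.\<close>
    using that nonneg by (intro exI[of _ 0]) (auto intro: order.trans[of _ 0])

  have upper: "\<exists>L>0. \<forall>u N. norm u < r \<longrightarrow> \<Phi> u \<le> L \<and> \<Phi>N N u \<le> L" if "0 < r" for r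
  proof -
    obtain M where M: "\<And>u N. w (G u) \<le> exp (1 * (norm u)\<^sup>2 + M)" "\<And>u N. w (GN N u) \<le> exp (1 * (norm u)\<^sup>2 + M)"
      using growth_w[of 1] by auto
    define L where "L = 1 / 2 * (w y + exp (r\<^sup>2 + M))\<^sup>2"
    have bound: "1 / 2 * (w (y - x))\<^sup>2 \<le> L" if "norm u < r" "w x \<le> exp (1 * (norm u)\<^sup>2 + M)" for x and u :: 'x
    proof -
      have "(norm u)\<^sup>2 \<le> r\<^sup>2" using that by (intro power_mono) auto
      then have "exp (1 * (norm u)\<^sup>2 + M) \<le> exp (r\<^sup>2 + M)" by simp
      with that w_diff[of y x] have "w (y - x) \<le> w y + exp (r\<^sup>2 + M)" by linarith
      then show ?thesis unfolding L_def by (intro mult_left_mono power_mono w_nonneg) auto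
    qed
    have "0 < w y + exp (r\<^sup>2 + M)" by (intro add_nonneg_pos w_nonneg exp_gt_zero)
    then have "0 < L" by (simp add: L_def)
    with bound M show ?thesis unfolding \<Phi>_eq \<Phi>N_eq by blast
  qed

  have close: "\<exists>K>0. \<forall>u N. \<bar>\<Phi> u - \<Phi>N N u\<bar> \<le> K * exp (\<epsilon> * (norm u)\<^sup>2) * \<psi> N" if \<epsilon>: "0 < \<epsilon>" for \<epsilon>
  proof -
    \<comment> \<open>Approximation and growth each contribute one exponential, so each is used with
      half of \<open>\<epsilon>\<close>.\<close>
    have \<epsilon>2: "0 < \<epsilon> / 2" using \<epsilon> by simp
    obtain M where M: "\<And>u. w (G u) \<le> exp (\<epsilon> / 2 * (norm u)\<^sup>2 + M)" "\<And>u N. w (GN N u) \<le> exp (\<epsilon> / 2 * (norm u)\<^sup>2 + M)"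
      using growth_w[OF \<epsilon>2] by blast
    obtain K' where K': "0 < K'" "\<And>u N. norm (G u - GN N u) \<le> K' * exp (\<epsilon> / 2 * (norm u)\<^sup>2) * \<psi> N"
      using approximation[OF \<epsilon>2] by blast
    \<comment> \<open>From \<open>p^2 - q^2 = (p - q) * (p + q)\<close>: the first factor gives
      \<open>c * K'\<close>, the second \<open>2 * (w y + exp M)\<close>, and this 2 cancels the 1/2
      in the potentials.\<close>
    define K where "K = c * K' * (w y + exp M)"
    have K: "0 < K" using c K' w_nonneg[of y] by (simp add: K_def add_nonneg_pos)
    have "\<bar>\<Phi> u - \<Phi>N N u\<bar> \<le> K * exp (\<epsilon> * (norm u)\<^sup>2) * \<psi> N" for u N
    proof -
      define p q e where "p = w (y - G u)" and "q = w (y - GN N u)" and "e = exp (\<epsilon> / 2 * (norm u)\<^sup>2)"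
      have e: "1 \<le> e" using \<epsilon> by (simp add: e_def)
      have "\<bar>p - q\<bar> \<le> w (G u - GN N u)"
        using w_rev[of "y - GN N u" "y - G u"] by (simp add: p_def q_def abs_minus_commute)
      also have "\<dots> \<le> c * (K' * e * \<psi> N)"
        unfolding e_def using c K'(2)[of u N] by (intro order.trans[OF c(2)] mult_left_mono) auto
      finally have diff: "\<bar>p - q\<bar> \<le> c * (K' * e * \<psi> N)" .
      have "p \<le> w y + e * exp M" "q \<le> w y + e * exp M"
        using w_diff[of y "G u"] w_diff[of y "GN N u"] M(1)[of u] M(2)[of N u]
        by (simp_all add: p_def q_def e_def exp_add)
      moreover have "w y \<le> w y * e" using mult_left_mono[OF e w_nonneg[of y]] by simp
      ultimately have sum: "p + q \<le> 2 * ((w y + exp M) * e)" by (simp add: algebra_simps)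
      have "0 \<le> p" "0 \<le> q" by (simp_all add: p_def q_def w_nonneg)
      have "\<bar>\<Phi> u - \<Phi>N N u\<bar> = 1 / 2 * (\<bar>p - q\<bar> * \<bar>p + q\<bar>)"
        unfolding \<Phi>_eq \<Phi>N_eq p_def[symmetric] q_def[symmetric] abs_mult[symmetric]
        by (simp add: power2_eq_square algebra_simps flip: diff_divide_distrib)
      also have "\<dots> \<le> 1 / 2 * (c * (K' * e * \<psi> N) * (2 * ((w y + exp M) * e)))"
        using diff sum \<open>0 \<le> p\<close> \<open>0 \<le> q\<close> by (intro mult_left_mono mult_mono) auto
      also have "\<dots> = K * (e * e) * \<psi> N" by (simp add: K_def)
      also have "e * e = exp (\<epsilon> * (norm u)\<^sup>2)" by (simp add: e_def flip: exp_add)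
      finally show ?thesis .
    qed
    with K show ?thesis by blast
  qed

  \<comment> \<open>The approximation bound at \<open>u = 0\<close> dominates a norm, which fixes
    the sign of \<open>\<psi>\<close>.\<close>
  have \<psi>_nonneg: "0 \<le> \<psi> N" for N
  proof -
    obtain K' where K': "0 < K'" "\<And>u N. norm (G u - GN N u) \<le> K' * exp (1 * (norm u)\<^sup>2) * \<psi> N"
      using approximation[of 1] by (metis zero_less_one)
    have "0 \<le> K' * \<psi> N"
      using order.trans[OF norm_ge_zero K'(2)[of 0 N]] by simp
    then show ?thesis using K'(1) by (simp add: zero_le_mult_iff)
  qed
  \<comment> \<open>An upper bound for \<open>\<psi>\<close> serves to bound the means of the
    perturbed measures uniformly in \<open>N\<close>.\<close>
  have "Bseq \<psi>" using \<psi> by (intro convergent_imp_Bseq convergentI)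
  then obtain \<Psi> where \<Psi>: "\<And>N. \<psi> N \<le> \<Psi>"
    unfolding Bseq_def by (metis abs_le_D1 real_norm_def)

  \<comment> \<open>Part (b): the Gaussian reference measure and comparison of the Gibbs
    measures\<close>
  have sets_\<mu>0: "sets \<mu>0 = sets borel" using \<mu>0 by (simp add: regarded_on_def)
  have prob_\<mu>0: "prob_space \<mu>0" by (rule prob_space_regarded_on[OF \<mu>0 full_measure])
  obtain a where a: "0 < a" "integrable \<mu>0 (\<lambda>u. exp (a * (norm u)\<^sup>2))"
    by (rule fernique_regarded_on[OF embedding gaussian full_measure \<mu>0])
  obtain s where s: "1 \<le> s" "measure \<mu>0 {u. s < norm u} \<le> 1 / 2"
    using tail_tendsto_zero[OF prob_\<mu>0 sets_\<mu>0, of "1 / 2"] by auto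
  \<comment> \<open>The complement of the tail is a closed ball of radius \<open>s\<close>; radius
    \<open>s + 1\<close> gives an open ball containing it.\<close>
  have "1 / 2 \<le> measure \<mu>0 {u. norm u < s + 1}"
  proof -
    interpret prob_space \<mu>0 by (rule prob_\<mu>0)
    have sp: "space \<mu>0 = UNIV" using sets_eq_imp_space_eq[OF sets_\<mu>0] by simp
    have "{u. s < norm u} \<in> sets \<mu>0"
      unfolding sets_\<mu>0 by (intro borel_open open_Collect_less continuous_intros)
    then have "1 / 2 \<le> prob (space \<mu>0 - {u. s < norm u})" using s(2) by (simp add: prob_compl)
    also have "\<dots> \<le> prob {u. norm u < s + 1}"
      by (intro finite_measure_mono) (auto simp: sets_\<mu>0 intro!: borel_open open_Collect_less continuous_intros)
    finally show ?thesis .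
  qed
  moreover obtain L where L: "\<And>u N. norm u < s + 1 \<Longrightarrow> \<Phi> u \<le> L \<and> \<Phi>N N u \<le> L"
    using upper[of "s + 1"] s(1) by auto
  ultimately interpret gibbs_reference \<mu>0 a "s + 1" L
    using prob_\<mu>0 sets_\<mu>0 a by (intro gibbs_reference.intro gibbs_reference_axioms.intro)

  have w_meas: "w \<in> borel_measurable borel"
    unfolding w by (intro borel_measurable_continuous_onI continuous_intros
        linear_continuous_on matrix_vector_mul_bounded_linear)
  have misfit_meas: "(\<lambda>u. 1 / 2 * (w (y - F u))\<^sup>2) \<in> borel_measurable borel"
    if [measurable]: "F \<in> borel_measurable borel" for F :: "'x \<Rightarrow> real ^ 'm"
    using w_meas by measurable
  have "\<Phi> = (\<lambda>u. 1 / 2 * (w (y - G u))\<^sup>2)" "\<Phi>N N = (\<lambda>u. 1 / 2 * (w (y - GN N u))\<^sup>2)" for N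
    by (intro ext \<Phi>_eq \<Phi>N_eq)+
  then have "\<Phi> \<in> borel_measurable borel" "\<Phi>N N \<in> borel_measurable borel" for N
    by (simp_all only: misfit_meas G_measurable)
  then have pot: "potential \<Phi>" and potN: "potential (\<Phi>N N)" for N
    unfolding potential_def using nonneg L by blast+
  \<comment> \<open>With \<open>\<epsilon> = a / 2\<close> the exponential in the closeness bound is
    exactly \<open>weight\<close>, and \<open>\<delta>\<close> becomes
    \<open>K * \<psi> N\<close>.\<close>
  obtain K where K: "0 < K" and close_K: "\<And>u N. \<bar>\<Phi> u - \<Phi>N N u\<bar> \<le> K * \<psi> N * weight u"
    using close[of "a / 2"] a(1) by (auto simp: weight_def mult_ac)

  have prob: "prob_space \<mu>" "prob_space (\<mu>N N)" for N
    unfolding \<mu> \<mu>N by (intro prob_space_gibbs pot potN)+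
  have hell: "\<exists>C. \<forall>N. hellinger \<mu>0 \<mu> (\<mu>N N) \<le> C * \<psi> N"
  proof -
    define C where "C = exp (- (ln z / 2)) * \<kappa> / 2 * sqrt weight_square_integral"
    have "hellinger \<mu>0 \<mu> (\<mu>N N) \<le> C * K * \<psi> N" for N
      unfolding \<mu> \<mu>N C_def using hellinger_gibbs_le[OF pot potN close_K] by (simp only: mult.assoc)
    then show ?thesis by blast
  qed

  have weight_powr: "norm u powr p \<le> exp (p\<^sup>2 / (4 * (a / 2))) * weight u" if "0 < p" for p and u :: 'x
    unfolding weight_def using a(1) that by (intro powr_le_exp_square) auto
  obtain B1 where B1: "\<And>u :: 'x. norm u \<le> B1 * weight u"
    using weight_powr[of 1] by fastforce
  obtain B2 where B2: "\<And>u :: 'x. (norm u)\<^sup>2 \<le> B2 * weight u"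
  proof
    show "(norm u)\<^sup>2 \<le> exp (2\<^sup>2 / (4 * (a / 2))) * weight u" for u :: 'x
      using weight_powr[of 2 u] by (cases "u = 0") auto
  qed

  define C where "C = \<kappa> * weight_square_integral / z"
  note integral_diff = integral_gibbs_diff_le[OF pot potN close_K, folded C_def]
  have moments: "integrable \<mu> (\<lambda>u. norm u powr p) \<and> (\<forall>N. integrable (\<mu>N N) (\<lambda>u. norm u powr p)) \<and>
      (\<exists>C. \<forall>N. \<bar>(\<integral>u. norm u powr p \<partial>\<mu>) - (\<integral>u. norm u powr p \<partial>\<mu>N N)\<bar> \<le> C * \<psi> N)" if p: "0 < p" for p
  proof -
    define B where "B = exp (p\<^sup>2 / (4 * (a / 2)))"
    have g: "(\<lambda>u :: 'x. norm u powr p) \<in> borel_measurable borel" by measurable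
    have B: "norm (norm u powr p) \<le> B * weight u" for u :: 'x
      using weight_powr[OF p] by (simp add: B_def)
    have "\<bar>(\<integral>u. norm u powr p \<partial>\<mu>) - (\<integral>u. norm u powr p \<partial>\<mu>N N)\<bar> \<le> C * B * K * \<psi> N" for N
      unfolding \<mu> \<mu>N using integral_diff[OF g B] by (simp add: mult.assoc)
    then show ?thesis
      unfolding \<mu> \<mu>N using integrable_gibbs[OF pot g B] integrable_gibbs[OF potN g B] by blast
  qed

  have id_meas: "(\<lambda>u :: 'x. u) \<in> borel_measurable borel" by measurable
  have int1: "integrable \<mu> (\<lambda>u. u)" "integrable (\<mu>N N) (\<lambda>u. u)" for N
    unfolding \<mu> \<mu>N by (intro integrable_gibbs[OF _ id_meas B1] pot potN)+
  have sq_meas: "(\<lambda>u :: 'x. (norm u)\<^sup>2) \<in> borel_measurable borel" by measurable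
  have sq_le: "norm ((norm u)\<^sup>2) \<le> B2 * weight u" for u :: 'x using B2[of u] by simp
  have int2: "integrable \<mu> (\<lambda>u. (norm u)\<^sup>2)" "integrable (\<mu>N N) (\<lambda>u. (norm u)\<^sup>2)" for N
    unfolding \<mu> \<mu>N by (intro integrable_gibbs[OF _ sq_meas sq_le] pot potN)+
  define D where "D = C * B1 * K"
  have mean_diff: "norm (mean \<mu> - mean (\<mu>N N)) \<le> D * \<psi> N" for N
    unfolding \<mu> \<mu>N mean_def D_def using integral_diff[OF id_meas B1] by (simp add: mult.assoc)

  have cov: "bounded_linear (covariance_operator ip \<mu>) \<and>
      (\<forall>N. bounded_linear (covariance_operator ip (\<mu>N N))) \<and>
      (\<exists>C. \<forall>N. onorm (\<lambda>h. covariance_operator ip \<mu> h - covariance_operator ip (\<mu>N N) h) \<le> C * \<psi> N)"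
    if ip: "inner_product_of_norm ip" for ip
  proof -
    interpret ip: bounded_bilinear ip by (rule inner_product_of_norm_bounded_bilinear[OF ip])
    have sets: "sets \<mu> = sets borel" "sets (\<mu>N N) = sets borel" for N by (simp_all add: \<mu> \<mu>N)
    note cov_eq = covariance_operator_eq[OF prob(1) sets(1) int1(1) int2(1) ip]
      covariance_operator_eq[OF prob(2) sets(2) int1(2) int2(2) ip]
    define m where "m = mean \<mu>"
    have D: "0 \<le> D * \<psi> N" for N using mean_diff[of N] norm_ge_zero order.trans by blast
    \<comment> \<open>The first summand comes from the second moments, the other from the rank-one
      terms of the means, where \<open>norm m + \<bar>D\<bar> * \<Psi>\<close> bounds the norm of
      the mean of every \<open>\<mu>N N\<close>.\<close>
    define E where "E = C * B2 * K + D * (norm m + (norm m + \<bar>D\<bar> * \<Psi>))"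
    have "norm (covariance_operator ip \<mu> h - covariance_operator ip (\<mu>N N) h) \<le> E * \<psi> N * norm h" for h N
    proof -
      define n where "n = mean (\<mu>N N)"
      have mn: "norm (m - n) \<le> D * \<psi> N" unfolding m_def n_def by (rule mean_diff)
      have "norm n \<le> norm m + norm (m - n)" using norm_triangle_ineq4[of m "m - n"] by simp
      also have "D * \<psi> N \<le> \<bar>D\<bar> * \<Psi>"
        using \<psi>_nonneg[of N] \<Psi>[of N] by (intro mult_mono) auto
      with mn have "norm m + norm (m - n) \<le> norm m + \<bar>D\<bar> * \<Psi>" by simp
      finally have n: "norm n \<le> norm m + \<bar>D\<bar> * \<Psi>" .
      have "norm (ip u h *\<^sub>R u) \<le> (B2 * norm h) * weight u" for u
        using norm_second_moment_integrand_le[OF prob(1) sets(1) int1(1) int2(1) ip, of u h]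
          mult_right_mono[OF B2[of u] norm_ge_zero[of h]] by (simp add: mult_ac)
      then have second: "norm ((\<integral>u. ip u h *\<^sub>R u \<partial>\<mu>) - (\<integral>u. ip u h *\<^sub>R u \<partial>\<mu>N N)) \<le> C * (B2 * norm h) * (K * \<psi> N)"
        unfolding \<mu> \<mu>N
        by (intro integral_diff
            second_moment_integrand_measurable[OF prob(1) sets(1) int1(1) int2(1) ip])
      \<comment> \<open>Telescoping the difference of the rank-one terms, so that each summand
        contains \<open>m - n\<close> once.\<close>
      have "ip m h *\<^sub>R m - ip n h *\<^sub>R n = ip (m - n) h *\<^sub>R m + ip n h *\<^sub>R (m - n)"
        by (simp add: ip.diff_left algebra_simps)
      also have "norm \<dots> \<le> norm (m - n) * norm h * norm m + norm n * norm h * norm (m - n)"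
        using inner_product_of_norm_Cauchy_Schwarz[OF ip]
        by (intro order.trans[OF norm_triangle_ineq] add_mono) (auto intro!: mult_right_mono)
      also have "\<dots> = norm (m - n) * (norm m + norm n) * norm h" by (simp add: algebra_simps)
      also have "\<dots> \<le> (D * \<psi> N) * (norm m + (norm m + \<bar>D\<bar> * \<Psi>)) * norm h"
        using mn n D[of N] by (intro mult_right_mono mult_mono) auto
      finally have first: "norm (ip m h *\<^sub>R m - ip n h *\<^sub>R n) \<le> (D * \<psi> N) * (norm m + (norm m + \<bar>D\<bar> * \<Psi>)) * norm h" .
      have "covariance_operator ip \<mu> h - covariance_operator ip (\<mu>N N) h =
          ((\<integral>u. ip u h *\<^sub>R u \<partial>\<mu>) - (\<integral>u. ip u h *\<^sub>R u \<partial>\<mu>N N)) - (ip m h *\<^sub>R m - ip n h *\<^sub>R n)"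
        by (simp add: cov_eq m_def n_def)
      also have "norm \<dots> \<le> C * (B2 * norm h) * (K * \<psi> N) + (D * \<psi> N) * (norm m + (norm m + \<bar>D\<bar> * \<Psi>)) * norm h"
        by (rule order.trans[OF norm_triangle_ineq4 add_mono[OF second first]])
      also have "\<dots> = E * \<psi> N * norm h" by (simp add: E_def algebra_simps)
      finally show ?thesis .
    qed
    \<comment> \<open>\<open>onorm_bound\<close> asks for a nonnegative constant, hence the absolute
      value.\<close>
    moreover have "E * \<psi> N \<le> \<bar>E\<bar> * \<psi> N" for N using \<psi>_nonneg[of N] by (intro mult_right_mono) auto
    ultimately have "norm (covariance_operator ip \<mu> h - covariance_operator ip (\<mu>N N) h) \<le> \<bar>E\<bar> * \<psi> N * norm h" for h N
      by (meson mult_right_mono norm_ge_zero order.trans)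
    then have "onorm (\<lambda>h. covariance_operator ip \<mu> h - covariance_operator ip (\<mu>N N) h) \<le> \<bar>E\<bar> * \<psi> N" for N
      using \<psi>_nonneg by (intro onorm_bound) auto
    then show ?thesis
      using bounded_linear_covariance_operator[OF prob(1) sets(1) int1(1) int2(1) ip]
        bounded_linear_covariance_operator[OF prob(2) sets(2) int1(2) int2(2) ip] by blast
  qed
  show ?thesis
    using lower upper close prob hell moments int1 mean_diff cov by blast
qed

end
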